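(* Let $n \geq 2$, let $K \subset \mathbb{R}^n$ be a compact set with positive volume, and assume $0<p<2$ if $n=2$, and $0<p\leq \frac{2}{n-1}$ if $n\geq 3$. If $K$ has an irreducible group of isometries, then the scale invariant quantity \[ C_p \sqrt{\frac{I^{n-1}}{V^{n+1}}} \] is minimal at $K$ among all nondegenerate linear images of $K$; that is, for every real invertible $n\times n$ matrix $M$, \[ C_p(K) \sqrt{\frac{I(K)^{n-1}}{V(K)^{n+1}}} \leq C_p(MK) \sqrt{\frac{I(MK)^{n-1}}{V(MK)^{n+1}}}, \] with equality if and only if $M$ is a euclidean similarity (a nonzero scalar multiple of an orthogonal matrix). In particular, for $p=1$: (i) if $K \subset \mathbb{R}^2$ is compact with rotational symmetry of order $\geq 3$ and positive area $A$, then $C_1 \sqrt{I/A^3}$ is minimal at $K$ among all nondegenerate linear images of $K$; (ii) if $K \subset \mathbb{R}^3$ is compact with an irreducible group of isometries and positive volume, then $C_1 I/V^2$ is minimal at $K$ among all nondegenerate linear images of $K$.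
   Context: The Riesz $p$-energy of a compact set $K \subset \mathbb{R}^n$, for $0<p<n$, is \[ V_p(K) = \min_\mu \int_K \int_K \frac{1}{|x-y|^p} \, d\mu(x)\, d\mu(y) \in (0,+\infty], \] where the minimum is over all Borel probability measures $\mu$ on $K$ (the minimum is attained). The $p$-capacity is $C_p(K) = V_p(K)^{-1/p}$, with value $0$ when $V_p(K)=+\infty$. $V(K)$ is the $n$-dimensional Lebesgue measure (volume) of $K$ (written $A(K)$, area, when $n=2$), and \[ I(K) = \int_K |x-\overline{x}|^2 \, dx, \qquad \overline{x} = \frac{1}{V(K)}\int_K x \, dx, \] is the second moment of $K$ about its centroid $\overline{x}$. An isometry of a set $K \subset \mathbb{R}^n$ is an orthogonal $n \times n$ matrix $U$ with $UK=K$. A group $\mathcal{U}$ of orthogonal $n\times n$ matrices is irreducible if the only subspaces of $\mathbb{R}^n$ invariant under the action of the group are $\{0\}$ and $\mathbb{R}^n$. A set $K\subset\mathbb{R}^2$ has rotational symmetry of order $N$ if it is mapped to itself by the rotation about the origin by angle $2\pi/N$. A nondegenerate linear image of $K$ is a set $MK=\{Mx : x\in K\}$ with $M$ a real invertible $n\times n$ matrix. *)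

theory Defs
  imports "HOL-Probability.Probability"
begin

section \<open>Riesz energy and capacity\<close>

definition borel_prob_measures_on :: "'a::topological_space set \<Rightarrow> 'a measure set" where
  "borel_prob_measures_on K =
     {\<mu>. prob_space \<mu> \<and> sets \<mu> = sets (restrict_space borel K)}"

text \<open>The division is in \<^typ>\<open>ennreal\<close>, where \<^term>\<open>1 / (0::ennreal) = \<infinity>\<close>, so the kernel is
  infinite on the diagonal.  (The real quotient would be \<^term>\<open>0::real\<close> there.)\<close>

definition riesz_kernel :: "real \<Rightarrow> 'a::real_normed_vector \<Rightarrow> 'a \<Rightarrow> ennreal" where
  "riesz_kernel p x y = 1 / ennreal (norm (x - y) powr p)"

text \<open>For compact nonempty \<^term>\<open>K\<close> and \<^term>\<open>0 < p\<close> the infimum is attained.\<close>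

definition riesz_energy :: "real \<Rightarrow> 'a::euclidean_space set \<Rightarrow> ennreal" where
  "riesz_energy p K =
     (INF \<mu>\<in>borel_prob_measures_on K.
        \<integral>\<^sup>+ y. (\<integral>\<^sup>+ x. riesz_kernel p x y \<partial>\<mu>) \<partial>\<mu>)"

definition riesz_capacity :: "real \<Rightarrow> 'a::euclidean_space set \<Rightarrow> real" where
  "riesz_capacity p K =
     (if riesz_energy p K = \<infinity> then 0 else enn2real (riesz_energy p K) powr (- 1 / p))"


section \<open>Volume, centroid and second moment\<close>

abbreviation vol :: "'a::euclidean_space set \<Rightarrow> real" where
  "vol K \<equiv> measure lebesgue K"

definition centroid :: "'a::euclidean_space set \<Rightarrow> 'a" where
  "centroid K = (1 / vol K) *\<^sub>R (LINT x:K|lebesgue. x)"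

definition second_moment :: "'a::euclidean_space set \<Rightarrow> real" where
  "second_moment K = (LINT x:K|lebesgue. (norm (x - centroid K))\<^sup>2)"


section \<open>Linear images and isometries\<close>

definition matrix_image :: "real^'n^'n \<Rightarrow> (real^'n) set \<Rightarrow> (real^'n) set" where
  "matrix_image M K = (\<lambda>x. M *v x) ` K"

definition isometry_of :: "real^'n^'n \<Rightarrow> (real^'n) set \<Rightarrow> bool" where
  "isometry_of U K \<longleftrightarrow> orthogonal_matrix U \<and> matrix_image U K = K"

definition orthogonal_matrix_group :: "(real^'n^'n) set \<Rightarrow> bool" where
  "orthogonal_matrix_group G \<longleftrightarrow>
     (\<forall>U\<in>G. orthogonal_matrix U) \<and>
     mat 1 \<in> G \<and> (\<forall>U\<in>G. \<forall>W\<in>G. U ** W \<in> G) \<and> (\<forall>U\<in>G. matrix_inv U \<in> G)"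

definition irreducible_group :: "(real^'n^'n) set \<Rightarrow> bool" where
  "irreducible_group G \<longleftrightarrow>
     (\<forall>S. subspace S \<and> (\<forall>U\<in>G. matrix_image U S \<subseteq> S) \<longrightarrow> S = {0} \<or> S = UNIV)"

definition has_irreducible_isometry_group :: "(real^'n) set \<Rightarrow> bool" where
  "has_irreducible_isometry_group K \<longleftrightarrow>
     (\<exists>G. orthogonal_matrix_group G \<and> (\<forall>U\<in>G. isometry_of U K) \<and> irreducible_group G)"

definition rotation_matrix :: "real \<Rightarrow> real^2^2" where
  "rotation_matrix t = vector [vector [cos t, - sin t], vector [sin t, cos t]]"

definition rotational_symmetry :: "nat \<Rightarrow> (real^2) set \<Rightarrow> bool" where
  "rotational_symmetry N K \<longleftrightarrow> matrix_image (rotation_matrix (2 * pi / real N)) K = K"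

definition euclidean_similarity :: "real^'n^'n \<Rightarrow> bool" where
  "euclidean_similarity M \<longleftrightarrow> (\<exists>c U. c \<noteq> 0 \<and> orthogonal_matrix U \<and> M = c *\<^sub>R U)"


section \<open>The scale invariant quantity\<close>

definition capacity_moment_ratio :: "real \<Rightarrow> (real^'n) set \<Rightarrow> real" where
  "capacity_moment_ratio p K =
     riesz_capacity p K *
       sqrt (second_moment K ^ (CARD('n) - 1) / vol K ^ (CARD('n) + 1))"

end

theory Submission
  imports Defs
begin

text \<open>
  Let \<open>N = M\<^sup>-\<^sup>1\<close> and let \<open>U\<close> run through the isometry group of \<open>K\<close>.  Pushing a measure on \<open>K\<close>
  forward by \<open>M U\<close> gives an upper bound for the energy of \<open>M K\<close>, and
  \<open>\<bar>y\<bar>\<^sup>2 = M y \<bullet> N\<^sup>T y \<le> \<bar>M y\<bar> \<bar>N\<^sup>T y\<bar>\<close> bounds \<open>\<bar>M U z\<bar>\<close> from below.  By irreducibility a suitable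
  convex combination over \<open>U\<close> turns \<open>\<bar>N\<^sup>T U z\<bar>\<^sup>2\<close> into \<open>(\<bar>N\<bar>\<^sup>2 / n) \<bar>z\<bar>\<^sup>2\<close> (Frobenius norm), so Jensen's inequality
  with exponent \<open>p / 2 \<le> 1\<close> yields \<open>V\<^sub>p(M K) \<le> (\<bar>N\<bar>\<^sup>2 / n)\<^sup>q V\<^sub>p(K)\<close> with \<open>q = p / 2\<close>.  The same averaging gives
  \<open>I(M K) = \<bar>det M\<bar> (\<bar>M\<bar>\<^sup>2 / n) I(K)\<close>.  What remains is Maclaurin's inequality between the elementary
  symmetric functions of degrees \<open>n - 1\<close> and \<open>1\<close> of the squared singular values of \<open>M\<close>.  Equality
  forces equal singular values: through Maclaurin if \<open>n \<ge> 3\<close>, and through the Cauchy-Schwarz and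
  Jensen steps if \<open>n = 2\<close>, where Maclaurin is an identity.
\<close>

section \<open>Elementary inequalities\<close>

text \<open>With \<open>t = (norm (matrix_inv M))^2 / n\<close> and
  \<open>t' = (norm M)^2 / n\<close>, the energy bound says that the capacity is multiplied by at
  least \<open>1 / sqrt t\<close>, whatever \<open>p\<close> is, because the exponent
  \<open>p / 2\<close> meets the \<open>- 1 / p\<close> of the capacity. The powers n - 1 and n + 1
  in the ratio leave the factor \<open>sqrt (t' ^ (n - 1) / (det M)^2)\<close>, so what has to be
  shown is \<open>(det M)^2 * t \<le> t' ^ (n - 1)\<close>. This is where the degrees n - 1 and 1
  come from. The obstacle is the equality case. The energy is an infimum, and strict inequalities
  between kernels do not pass to infima. Strictness is therefore carried by a constant: the energy
  is multiplied by at most some \<open>C\<close>, which in the plane lies strictly below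
  \<open>t powr (p / 2)\<close>. This is decisive because the energy of \<open>K\<close> is positive
  and finite.\<close>

lemma bernoulli_homogeneous:
  fixes m x :: real
  assumes "0 < m" "0 \<le> m + x"
  shows "m ^ Suc k + real (Suc k) * x * m ^ k \<le> (m + x) ^ Suc k"
proof -
  have "1 + real (Suc k) * (x / m) \<le> (1 + x / m) ^ Suc k"
    by (rule Bernoulli_inequality) (use assms in \<open>simp add: field_simps\<close>)
  then have "m ^ Suc k * (1 + real (Suc k) * (x / m)) \<le> m ^ Suc k * (1 + x / m) ^ Suc k"
    using assms by (intro mult_left_mono) auto
  moreover have "m ^ Suc k * (1 + x / m) ^ Suc k = (m + x) ^ Suc k"
    using assms by (simp add: power_mult_distrib[symmetric] field_simps del: power_Suc)
  moreover have "m ^ Suc k * (1 + real (Suc k) * (x / m)) = m ^ Suc k + real (Suc k) * x * m ^ k"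
    using assms by (simp add: field_simps)
  ultimately show ?thesis by simp
qed

text \<open>The base case is \<open>(m + x)^2 - m^2 - 2 * x * m = x * x > 0\<close>; each induction
  step multiplies by \<open>m + x > 0\<close> and discards a nonnegative multiple of
  \<open>x * x\<close>. For \<open>k = 0\<close> both sides agree, hence
  \<open>0 < k\<close>.\<close>

lemma bernoulli_homogeneous_strict:
  fixes m x :: real
  assumes "0 < m" "0 < m + x" "x \<noteq> 0" "0 < k"
  shows "m ^ Suc k + real (Suc k) * x * m ^ k < (m + x) ^ Suc k"
  using assms(4)
proof (induction k rule: nat_induct_non_zero)
  case 1
  have "0 < x * x" using assms by (auto simp: zero_less_mult_iff)
  then show ?case by (simp add: algebra_simps)
next
  case (Suc k)
  have "(m + x) * (m ^ Suc k + real (Suc k) * x * m ^ k) < (m + x) * (m + x) ^ Suc k"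
    using Suc assms by (intro mult_strict_left_mono) auto
  moreover have "(m + x) * (m ^ Suc k + real (Suc k) * x * m ^ k)
      = m ^ Suc (Suc k) + real (Suc (Suc k)) * x * m ^ Suc k + real (Suc k) * (x * x) * m ^ k"
    by (simp add: algebra_simps)
  moreover have "0 \<le> real (Suc k) * (x * x) * m ^ k" using assms by simp
  ultimately show ?case by simp
qed

text \<open>The elementary symmetric function of degree \<open>card S - 1\<close> is written as
  \<open>prod b S * (\<Sum>i\<in>S. 1 / b i)\<close>.\<close>

lemma mean_insert:
  fixes s b k :: real
  assumes "0 < k"
  shows "s / k + (b - s / k) / (1 + k) = (b + s) / (1 + k)"
proof -
  have "s + s / k = s / k * (1 + k)" using assms by (simp add: distrib_left)
  then have "s / k = (s + s / k) / (1 + k)" using assms by simp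
  then have "s / k + (b - s / k) / (1 + k) = (s + s / k + (b - s / k)) / (1 + k)"
    by (metis add_divide_distrib)
  then show ?thesis by (simp add: add.commute)
qed

text \<open>Adjoining \<open>b j\<close> to k numbers with mean \<open>m\<close> moves the mean by
  \<open>d\<close>, where \<open>b j = m + (k + 1) * d\<close>. By induction the new product is at
  most \<open>b j * m ^ k\<close>, which is the first-order expansion of
  \<open>(m + d) ^ (k + 1)\<close> at \<open>m\<close>; Bernoulli's inequality bounds it by that
  power.\<close>

lemma am_gm_power:
  fixes b :: "'i \<Rightarrow> real"
  assumes "finite S" "S \<noteq> {}" "\<And>i. i \<in> S \<Longrightarrow> 0 < b i"
  shows "prod b S \<le> (sum b S / card S) ^ card S"
  using assms
proof (induction S rule: finite_ne_induct)
  case (insert j S)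
  define m where "m = sum b S / card S"
  define d where "d = (b j - m) / real (Suc (card S))"
  have k: "0 < card S" using insert by (simp add: card_gt_0_iff)
  have m: "0 < m" unfolding m_def using insert k by (intro divide_pos_pos sum_pos) auto
  have mean: "m + d = sum b (insert j S) / card (insert j S)"
    unfolding m_def d_def using insert k mean_insert[of "card S" "sum b S" "b j"] by simp
  have nn: "0 \<le> m + d" unfolding mean
    using insert by (intro divide_nonneg_nonneg sum_nonneg less_imp_le) auto
  have bj: "b j = m + real (Suc (card S)) * d" by (simp add: d_def)
  have "prod b (insert j S) \<le> b j * m ^ card S"
    unfolding m_def using insert by (simp add: mult_left_mono less_imp_le)
  also have "\<dots> = m ^ Suc (card S) + real (Suc (card S)) * d * m ^ card S"
    by (simp add: bj algebra_simps)
  also have "\<dots> \<le> (m + d) ^ Suc (card S)" by (rule bernoulli_homogeneous[OF m nn])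
  finally show ?case unfolding mean using insert by simp
qed auto

text \<open>Splitting off \<open>j\<close> turns the symmetric function of \<open>insert j T\<close>
  into \<open>prod b T + b j * (prod b T * (\<Sum>i\<in>T. 1 / b i))\<close>. AM-GM bounds the first
  summand, the induction hypothesis the second, and the sum of the bounds is again a first-order
  expansion of a power of the new mean. For strictness one strict Bernoulli step suffices; with two
  elements the claim is an identity.\<close>

lemma
  fixes b :: "'i \<Rightarrow> real"
  assumes S: "finite S" and pos: "\<And>i. i \<in> S \<Longrightarrow> 0 < b i"
  shows maclaurin_ineq:
      "S \<noteq> {} \<Longrightarrow> prod b S * (\<Sum>i\<in>S. 1 / b i) \<le> card S * (sum b S / card S) ^ (card S - 1)"
    and maclaurin_ineq_strict:
      "3 \<le> card S \<Longrightarrow> j \<in> S \<Longrightarrow> b j \<noteq> sum b S / card S \<Longrightarrow>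
        prod b S * (\<Sum>i\<in>S. 1 / b i) < card S * (sum b S / card S) ^ (card S - 1)"
proof -
  \<comment> \<open>The bound is recorded before Bernoulli's inequality is applied, since the two
    claims finish with its weak and its strict form.\<close>
  have step: "prod b (insert j T) * (\<Sum>i\<in>insert j T. 1 / b i)
        \<le> real (Suc (Suc k)) * (m ^ Suc k + real (Suc k) * d * m ^ k)"
      "m + d = sum b (insert j T) / card (insert j T)" "0 < m" "0 < m + d"
    if "finite T" "j \<notin> T" "\<And>i. i \<in> insert j T \<Longrightarrow> 0 < b i" and kT: "card T = Suc k"
      and mT: "m = sum b T / card T" and d: "d = (b j - m) / real (Suc (Suc k))"
      and IH: "prod b T * (\<Sum>i\<in>T. 1 / b i) \<le> card T * m ^ (card T - 1)" for T j k and m d :: real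
  proof -
    have ne: "T \<noteq> {}" using kT by auto
    have bj: "0 < b j" using that by simp
    show "0 < m" unfolding mT using that ne by (intro divide_pos_pos sum_pos) auto
    show mean: "m + d = sum b (insert j T) / card (insert j T)"
      unfolding d mT using that mean_insert[of "card T" "sum b T" "b j"] by simp
    show "0 < m + d" unfolding mean using that by (intro divide_pos_pos sum_pos) auto
    have "prod b (insert j T) * (\<Sum>i\<in>insert j T. 1 / b i)
        = prod b T + b j * (prod b T * (\<Sum>i\<in>T. 1 / b i))"
      using that(1,2) bj by (simp add: distrib_left mult.assoc)
    also have "\<dots> \<le> m ^ Suc k + b j * (card T * m ^ (card T - 1))"
      using am_gm_power[of T b] that ne bj
      by (intro add_mono mult_left_mono) (auto simp: less_imp_le)
    also have "b j = m + real (Suc (Suc k)) * d" unfolding d by (simp add: field_simps)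
    also have "m ^ Suc k + (m + real (Suc (Suc k)) * d) * (card T * m ^ (card T - 1))
        = real (Suc (Suc k)) * (m ^ Suc k + real (Suc k) * d * m ^ k)"
      using kT by (simp add: algebra_simps)
    finally show "prod b (insert j T) * (\<Sum>i\<in>insert j T. 1 / b i)
        \<le> real (Suc (Suc k)) * (m ^ Suc k + real (Suc k) * d * m ^ k)" .
  qed
  have main: "prod b T * (\<Sum>i\<in>T. 1 / b i) \<le> card T * (sum b T / card T) ^ (card T - 1)"
    if "finite T" "T \<noteq> {}" "\<And>i. i \<in> T \<Longrightarrow> 0 < b i" for T
    using that
  proof (induction T rule: finite_ne_induct)
    case (singleton x)
    then have "0 < b x" by auto
    then show ?case by simp
  next
    case (insert j T)
    then obtain k where k: "card T = Suc k" by (metis card_0_eq not0_implies_Suc)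
    define m where "m = sum b T / card T"
    define d where "d = (b j - m) / real (Suc (Suc k))"
    note s = step[of T j k m d, OF insert.hyps(1,3) _ k m_def d_def]
    have IH: "prod b T * (\<Sum>i\<in>T. 1 / b i) \<le> card T * m ^ (card T - 1)"
      unfolding m_def using insert by auto
    note s = s[OF insert.prems IH, simplified]
    have "real (Suc (Suc k)) * (m ^ Suc k + real (Suc k) * d * m ^ k)
        \<le> real (Suc (Suc k)) * (m + d) ^ Suc k"
      using s(3,4) by (intro mult_left_mono bernoulli_homogeneous) auto
    with s(1) s(2) show ?case using insert k by simp
  qed
  show "prod b S * (\<Sum>i\<in>S. 1 / b i) \<le> card S * (sum b S / card S) ^ (card S - 1)" if "S \<noteq> {}"
    using main[OF S that pos] .
  show "prod b S * (\<Sum>i\<in>S. 1 / b i) < card S * (sum b S / card S) ^ (card S - 1)"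
    if c: "3 \<le> card S" and j: "j \<in> S" and neq: "b j \<noteq> sum b S / card S"
  proof -
    \<comment> \<open>The element off the mean is adjoined last, so that the final shift
      \<open>d\<close> is nonzero; \<open>3 \<le> card S\<close> makes \<open>k\<close> positive, as
      the strict Bernoulli inequality needs.\<close>
    define T where "T = S - {j}"
    have S_eq: "S = insert j T" "j \<notin> T" "finite T" using j S by (auto simp: T_def)
    obtain k where k: "card T = Suc k" "0 < k"
      using c S_eq by (metis Suc_le_mono card_insert_disjoint le_0_eq less_eq_Suc_le 
          not0_implies_Suc numeral_3_eq_3 gr0I not_less_eq_eq)
    define m where "m = sum b T / card T"
    define d where "d = (b j - m) / real (Suc (Suc k))"
    have IH: "prod b T * (\<Sum>i\<in>T. 1 / b i) \<le> card T * m ^ (card T - 1)"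
      unfolding m_def using main[of T] S_eq pos k by force
    note s = step[of T j k m d, OF S_eq(3,2) _ k(1) m_def d_def IH, folded S_eq(1), OF pos, simplified]
    have "d \<noteq> 0"
    proof
      assume "d = 0"
      then have "b j = m" by (simp add: d_def)
      then show False using neq s(2) \<open>d = 0\<close> by simp
    qed
    then have "real (Suc (Suc k)) * (m ^ Suc k + real (Suc k) * d * m ^ k)
        < real (Suc (Suc k)) * (m + d) ^ Suc k"
      using s(3,4) k by (intro mult_strict_left_mono bernoulli_homogeneous_strict) auto
    with s(1) s(2) show ?thesis using S_eq k by simp
  qed
qed

text \<open>Concavity of the power. After scaling by \<open>t\<close> the claim is
  \<open>x powr q \<le> y\<close> for the weighted mean \<open>y = q * x + (1 - q)\<close>. The
  inequality \<open>ln z \<le> z - 1\<close> is taken at \<open>x / y\<close> and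
  \<open>1 / y\<close> with weights \<open>q\<close> and \<open>1 - q\<close>: the right sides
  cancel and the left sides add up to \<open>q * ln x - ln y\<close>. For
  \<open>x \<noteq> 1\<close> the second use is strict.\<close>

lemma powr_le_tangent:
  fixes t s q :: real
  assumes "0 < t" "0 < s" "0 \<le> q" "q \<le> 1"
  shows "s powr q \<le> t powr q + q * t powr (q - 1) * (s - t)"
    and "0 < q \<Longrightarrow> q < 1 \<Longrightarrow> s \<noteq> t \<Longrightarrow> s powr q < t powr q + q * t powr (q - 1) * (s - t)"
proof -
  define x where "x = s / t"
  define y where "y = 1 + q * (x - 1)"
  have x: "0 < x" using assms by (simp add: x_def)
  have y: "0 < y" unfolding y_def
    using assms x by (smt (verit, best) mult_le_cancel_right1 mult_nonneg_nonneg right_diff_distrib')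
  have fin: "t powr q + q * t powr (q - 1) * (s - t) = t powr q * y"
    using assms by (simp add: y_def x_def powr_diff field_simps)
  have sq: "s powr q = t powr q * x powr q"
    using assms by (simp add: x_def powr_divide)
  have sum0: "q * (x / y - 1) + (1 - q) * (1 / y - 1) = 0"
    using y by (simp add: field_simps) (simp add: y_def algebra_simps)
  have l1: "ln (x / y) \<le> x / y - 1" "ln (1 / y) \<le> 1 / y - 1"
    using x y by (auto intro!: ln_le_minus_one)
  have lnx: "q * ln (x / y) + (1 - q) * ln (1 / y) = q * ln x - ln y"
    using x y by (simp add: ln_div algebra_simps)
  have "q * ln (x / y) + (1 - q) * ln (1 / y) \<le> 0"
    using mult_left_mono[OF l1(1), of q] mult_left_mono[OF l1(2), of "1 - q"] assms sum0 by simp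
  then have "x powr q \<le> y"
    using lnx x y by (simp add: powr_def flip: ln_ge_iff)
  then show "s powr q \<le> t powr q + q * t powr (q - 1) * (s - t)"
    unfolding fin sq using assms by simp
  show "s powr q < t powr q + q * t powr (q - 1) * (s - t)" if "0 < q" "q < 1" "s \<noteq> t"
  proof -
    have "x \<noteq> 1" using that assms by (auto simp: x_def)
    then have "1 / y \<noteq> 1" using that by (auto simp: y_def)
    then have "ln (1 / y) < 1 / y - 1"
      using l1(2) ln_eq_minus_one[of "1 / y"] y by fastforce
    then have "q * ln (x / y) + (1 - q) * ln (1 / y) < 0"
      using mult_left_mono[OF l1(1), of q] mult_strict_left_mono[of "ln (1/y)" "1/y-1" "1 - q"] that sum0 by linarith
    then have "q * ln x < ln y" using lnx by simp
    then have "x powr q < y" using x y exp_less_mono[of "q * ln x" "ln y"] by (simp add: powr_def)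
    then show ?thesis unfolding fin sq using assms by simp
  qed
qed

section \<open>Spectral theorem and singular values\<close>

text \<open>A maximiser \<open>v\<close> of the Rayleigh quotient on the unit sphere of
  \<open>W\<close> is an eigenvector: the residual \<open>u\<close> stays in \<open>W\<close> by
  invariance, and comparing \<open>v\<close> with \<open>v + t *\<^sub>R u\<close> gives an
  inequality whose term linear in \<open>t\<close> forces \<open>u = 0\<close>.\<close>

lemma selfadjoint_eigenvector_in_subspace:
  fixes f :: "'a::euclidean_space \<Rightarrow> 'a"
  assumes f: "linear f" and sym: "\<And>x y. f x \<bullet> y = x \<bullet> f y"
    and W: "subspace W" "W \<noteq> {0}" and inv: "\<And>x. x \<in> W \<Longrightarrow> f x \<in> W"
  obtains v l where "v \<in> W" "norm v = 1" "f v = l *\<^sub>R v"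
proof -
  interpret linear f by fact
  let ?C = "W \<inter> sphere 0 1"
  have "compact ?C" using W by (intro closed_Int_compact closed_subspace) auto
  moreover have "?C \<noteq> {}"
  proof -
    obtain w where "w \<in> W" "w \<noteq> 0" using W subspace_0 by blast
    then have "(1 / norm w) *\<^sub>R w \<in> ?C" using W by (auto intro: subspace_scale)
    then show ?thesis by blast
  qed
  moreover have "continuous_on ?C (\<lambda>x. x \<bullet> f x)"
    using linear_continuous_on[of f] f by (intro continuous_intros) (auto simp: linear_conv_bounded_linear)
  ultimately obtain v where v: "v \<in> ?C" and max: "\<And>y. y \<in> ?C \<Longrightarrow> y \<bullet> f y \<le> v \<bullet> f v"
    using continuous_attains_sup[of ?C "\<lambda>x. x \<bullet> f x"] by blast
  define l where "l = v \<bullet> f v"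
  have vv: "v \<bullet> v = 1" using v by (simp add: dot_square_norm)
  have max_hom: "w \<bullet> f w \<le> l * (w \<bullet> w)" if "w \<in> W" for w
  proof (cases "w = 0")
    case False
    then have "(1 / norm w) *\<^sub>R w \<in> ?C" using W that by (auto intro: subspace_scale)
    from max[OF this] False show ?thesis
      by (simp add: l_def scale field_simps dot_square_norm power2_eq_square)
  qed simp
  define u where "u = f v - l *\<^sub>R v"
  have uW: "u \<in> W" unfolding u_def using v inv W by (auto intro!: subspace_diff subspace_scale)
  define C where "C = l * (u \<bullet> u) - u \<bullet> f u"
  have bound: "2 * t * (u \<bullet> u) \<le> t\<^sup>2 * C" for t
  proof -
    have "(v + t *\<^sub>R u) \<bullet> f (v + t *\<^sub>R u) \<le> l * ((v + t *\<^sub>R u) \<bullet> (v + t *\<^sub>R u))"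
      using v uW W by (intro max_hom subspace_add subspace_scale) auto
    moreover have "u \<bullet> f v = u \<bullet> u + l * (u \<bullet> v)"
      by (simp add: u_def algebra_simps)
    moreover have "v \<bullet> f u = u \<bullet> f v" by (metis sym inner_commute)
    ultimately show ?thesis
      by (simp add: add scale C_def vv power2_eq_square algebra_simps
          inner_commute[of v u] flip: l_def)
  qed
  have "u \<bullet> u = 0"
  proof (rule ccontr)
    assume "u \<bullet> u \<noteq> 0"
    then have pos: "0 < u \<bullet> u" by simp
    \<comment> \<open>Chosen so that \<open>t * C\<close> is at most \<open>u \<bullet> u\<close>,
      too small to dominate \<open>2 * (u \<bullet> u)\<close>.\<close>
    define t where "t = (u \<bullet> u) / (\<bar>C\<bar> + 1)"
    have t: "0 < t" using pos by (simp add: t_def)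
    have "t * (2 * (u \<bullet> u)) \<le> t * (t * C)" using bound[of t] by (simp add: power2_eq_square mult_ac)
    then have "2 * (u \<bullet> u) \<le> t * C" using t by simp
    also have "\<dots> \<le> t * (\<bar>C\<bar> + 1)" using t by (intro mult_left_mono) auto
    also have "\<dots> = u \<bullet> u" by (simp add: t_def)
    finally show False using pos by simp
  qed
  then have "f v = l *\<^sub>R v" by (simp add: u_def)
  then show thesis using that v by auto
qed

text \<open>An orthonormal set of eigenvectors of maximal cardinality is a basis: otherwise its
  orthogonal complement is nonzero and, by self-adjointness, invariant, so it contains a further
  eigenvector.\<close>

lemma selfadjoint_orthonormal_eigenbasis:
  fixes f :: "'a::euclidean_space \<Rightarrow> 'a"
  assumes f: "linear f" and sym: "\<And>x y. f x \<bullet> y = x \<bullet> f y"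
  obtains B where "finite B" "card B = DIM('a)" "pairwise orthogonal B"
    "\<And>b. b \<in> B \<Longrightarrow> norm b = 1" "\<And>b. b \<in> B \<Longrightarrow> \<exists>l. f b = l *\<^sub>R b"
proof -
  interpret linear f by fact
  define P where "P B \<longleftrightarrow> pairwise orthogonal B \<and> (\<forall>b\<in>B. norm b = 1 \<and> (\<exists>l. f b = l *\<^sub>R b))" for B
  have fin: "finite B \<and> card B \<le> DIM('a)" if "P B" for B
  proof -
    have "independent B" using that unfolding P_def
      by (intro pairwise_orthogonal_independent) auto
    then show ?thesis using independent_bound by auto
  qed
  have "P {}" by (simp add: P_def)
  then obtain B where B: "P B" and maxB: "\<And>B'. P B' \<Longrightarrow> card B' \<le> card B"
    using ex_has_greatest_nat[of P "{}" card "Suc DIM('a)"] fin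
    by (metis le_imp_less_Suc)
  have "card B = DIM('a)"
  proof (rule ccontr)
    assume ne: "card B \<noteq> DIM('a)"
    define W where "W = {x. \<forall>b\<in>B. orthogonal b x}"
    have W: "subspace W" unfolding W_def by (auto simp: subspace_def orthogonal_clauses)
    have "span B \<noteq> UNIV"
    proof
      assume "span B = UNIV"
      then have "dim (UNIV :: 'a set) \<le> card B"
        using fin[OF B] dim_le_card[of UNIV B] by simp
      then show False using ne fin[OF B] by simp
    qed
    then obtain x where "x \<noteq> 0" "\<And>y. y \<in> span B \<Longrightarrow> orthogonal x y"
      using orthogonal_to_subspace_exists_gen[of B UNIV] by auto
    then have "x \<in> W" "x \<noteq> 0" by (auto simp: W_def span_base orthogonal_commute)
    then have W0: "W \<noteq> {0}" by auto
    have inv: "f x \<in> W" if "x \<in> W" for x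
    proof -
      have "b \<bullet> f x = 0" if b: "b \<in> B" for b
      proof -
        obtain l where "f b = l *\<^sub>R b" using B b by (auto simp: P_def)
        moreover have "b \<bullet> x = 0" using \<open>x \<in> W\<close> b by (auto simp: W_def orthogonal_def)
        ultimately show ?thesis by (simp flip: sym)
      qed
      then show ?thesis by (simp add: W_def orthogonal_def)
    qed
    obtain v l where v: "v \<in> W" "norm v = 1" "f v = l *\<^sub>R v"
      using selfadjoint_eigenvector_in_subspace[OF f sym W W0 inv] by metis
    have "v \<notin> B"
    proof
      assume "v \<in> B"
      then have "v \<bullet> v = 0" using v(1) by (simp add: W_def orthogonal_def)
      then show False using v(2) by simp
    qed
    have "P (insert v B)"
      using B v unfolding P_def W_def
      by (auto simp: pairwise_insert orthogonal_commute)
    from maxB[OF this] \<open>v \<notin> B\<close> fin[OF B] show False by simp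
  qed
  then show thesis using that[of B] fin[OF B] B unfolding P_def by blast
qed

section \<open>Diagonal matrices, Frobenius norm and singular values\<close>

definition diag_matrix :: "('n \<Rightarrow> real) \<Rightarrow> real^'n^'n" where
  "diag_matrix d = (\<chi> i j. if i = j then d i else 0)"

lemma diag_matrix_mult: "diag_matrix a ** diag_matrix b = diag_matrix (\<lambda>i. a i * b i)"
  by (simp add: diag_matrix_def matrix_matrix_mult_def vec_eq_iff mult_delta_left mult_delta_right)

lemma transpose_diag_matrix [simp]: "transpose (diag_matrix a) = diag_matrix a"
  by (auto simp: diag_matrix_def transpose_def vec_eq_iff)

lemma diag_matrix_const: "diag_matrix (\<lambda>_. c) = c *\<^sub>R mat 1"
  by (auto simp: diag_matrix_def mat_def vec_eq_iff)

lemma det_diag_matrix: "det (diag_matrix a) = (\<Prod>i\<in>UNIV. a i)"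
  by (subst det_diagonal) (auto simp: diag_matrix_def)

lemma diag_matrix_vector: "(diag_matrix a *v x) $ i = a i * x $ i"
  by (simp add: diag_matrix_def matrix_vector_mult_def mult_delta_left mult_delta_right)

lemma symmetric_matrix_inner:
  assumes "transpose P = (P :: real^'n^'n)"
  shows "(P *v x) \<bullet> y = x \<bullet> (P *v y)"
  using dot_lmul_matrix[of x P y] assms by (metis vector_transpose_matrix)

lemma symmetric_matrix_diagonalizable:
  fixes P :: "real^'n^'n"
  assumes "transpose P = P"
  obtains R b where "orthogonal_matrix R" "P = transpose R ** diag_matrix b ** R"
proof -
  obtain B where B: "finite B" "card B = DIM(real^'n)" "pairwise orthogonal B"
    "\<And>b. b \<in> B \<Longrightarrow> norm b = 1" "\<And>b. b \<in> B \<Longrightarrow> \<exists>l. P *v b = l *\<^sub>R b"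
    using selfadjoint_orthonormal_eigenbasis[of "(*v) P"] symmetric_matrix_inner[OF assms] by auto
  have "card (UNIV :: 'n set) = card B" using B by simp
  then obtain h where h: "bij_betw h (UNIV :: 'n set) B"
    using finite_same_card_bij B(1) finite_class.finite_UNIV by blast
  have hB: "h i \<in> B" for i using h by (auto simp: bij_betw_def)
  obtain l where l: "\<And>b. b \<in> B \<Longrightarrow> P *v b = l b *\<^sub>R b" using B(5) by metis
  \<comment> \<open>The eigenvectors become the rows of \<open>R\<close>, so
    \<open>R ** P ** transpose R\<close> has the entries
    \<open>h i \<bullet> (P *v h j)\<close>.\<close>
  define R where "R = (\<chi> i. h i)"
  have rowR: "row i R = h i" for i by (simp add: R_def row_def vec_eq_iff)
  have inner_h: "h i \<bullet> h j = (if i = j then 1 else 0)" for i j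
    using B(3) hB[of i] hB[of j] B(4)[OF hB[of i]] h
    by (auto simp: pairwise_def orthogonal_def dot_square_norm bij_betw_def inj_on_def)
  have R: "orthogonal_matrix R"
    unfolding orthogonal_matrix_orthonormal_rows rowR
    using inner_h B(4)[OF hB] by (auto simp: orthogonal_def)
  define b where "b i = l (h i)" for i
  have RPR: "R ** P ** transpose R = diag_matrix b"
  proof -
    have "(R ** P ** transpose R) $ i $ j = diag_matrix b $ i $ j" for i j
    proof -
      have "(R ** P ** transpose R) $ i $ j = (R ** (P ** transpose R)) $ i $ j"
        by (simp add: matrix_mul_assoc)
      also have "\<dots> = h i \<bullet> (P *v h j)"
        by (simp add: R_def inner_vec_def matrix_matrix_mult_def matrix_vector_mult_def transpose_def)
      also have "\<dots> = (if i = j then b i else 0)"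
        by (simp add: l[OF hB] inner_h b_def)
      finally show ?thesis by (simp add: diag_matrix_def)
    qed
    then show ?thesis by (simp add: vec_eq_iff)
  qed
  have "transpose R ** diag_matrix b ** R = (transpose R ** R) ** P ** (transpose R ** R)"
    unfolding RPR[symmetric] by (simp add: matrix_mul_assoc)
  then have "P = transpose R ** diag_matrix b ** R"
    using R by (simp add: orthogonal_matrix_def)
  then show thesis using that R by blast
qed

text \<open>The inner product of \<open>real^'n^'m\<close> sums over all entries; hence
  \<open>norm\<close> of a matrix is the Frobenius norm, not the operator norm.\<close>

lemma inner_matrix_eq_trace: "A \<bullet> B = trace (transpose A ** (B :: real^'n^'m))"
  unfolding inner_vec_def trace_def matrix_matrix_mult_def transpose_def
  by (simp, rule sum.swap)

lemma norm_matrix_sq: "(norm (A :: real^'n^'m))\<^sup>2 = trace (transpose A ** A)"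
  by (simp add: power2_norm_eq_inner inner_matrix_eq_trace)

lemma norm_orthogonal_mult:
  fixes A :: "real^'n^'n"
  assumes "orthogonal_matrix Q"
  shows "norm (Q ** A) = norm A" "norm (A ** Q) = norm A"
proof -
  have "transpose (Q ** A) ** (Q ** A) = transpose A ** (transpose Q ** Q) ** A"
    by (simp add: matrix_transpose_mul matrix_mul_assoc)
  then have "(norm (Q ** A))\<^sup>2 = (norm A)\<^sup>2"
    using assms by (simp add: norm_matrix_sq orthogonal_matrix_def)
  then show "norm (Q ** A) = norm A" by simp
  have "trace (transpose Q ** (transpose A ** A ** Q)) = trace (transpose A ** A ** (Q ** transpose Q))"
    by (subst trace_mul_sym) (simp add: matrix_mul_assoc)
  also have "\<dots> = trace (transpose A ** A)"
    using assms by (simp add: orthogonal_matrix_def)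
  finally have "(norm (A ** Q))\<^sup>2 = (norm A)\<^sup>2"
    by (simp add: norm_matrix_sq matrix_transpose_mul matrix_mul_assoc)
  then show "norm (A ** Q) = norm A" by simp
qed

lemma norm_diag_matrix_sq: "(norm (diag_matrix a :: real^'n^'n))\<^sup>2 = (\<Sum>i\<in>UNIV. (a i)\<^sup>2)"
  by (simp add: norm_matrix_sq diag_matrix_mult trace_def)
     (simp add: diag_matrix_def power2_eq_square)

lemma norm_matrix_vector_sq: "(norm ((A :: real^'n^'m) *v x))\<^sup>2 = x \<bullet> ((transpose A ** A) *v x)"
proof -
  have "x \<bullet> ((transpose A ** A) *v x) = x \<bullet> (transpose A *v (A *v x))"
    by (simp add: matrix_vector_mul_assoc)
  also have "\<dots> = (A *v x) \<bullet> (A *v x)"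
    by (metis dot_lmul_matrix vector_transpose_matrix transpose_transpose)
  finally show ?thesis by (simp add: power2_norm_eq_inner)
qed

lemma orthogonal_matrix_norm: "orthogonal_matrix (Q :: real^'n^'n) \<Longrightarrow> norm (Q *v x) = norm x"
  using norm_matrix_vector_sq[of Q x] by (simp add: orthogonal_matrix flip: power2_norm_eq_inner)

lemma invertible_matrix_inv:
  assumes "invertible (M :: real^'n^'n)"
  shows "M ** matrix_inv M = mat 1" "matrix_inv M ** M = mat 1"
  using someI_ex[OF assms[unfolded invertible_def]] by (auto simp: matrix_inv_def)

text \<open>Diagonalise \<open>transpose M ** M\<close> by \<open>R\<close>. The columns of
  \<open>M ** transpose R\<close> are then orthogonal with squared lengths \<open>b i\<close>,
  positive by invertibility; dividing them by \<open>a i = sqrt (b i)\<close> gives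
  \<open>Q\<close>.\<close>

lemma singular_value_decomposition:
  fixes M :: "real^'n^'n"
  assumes "invertible M"
  obtains Q R a where "orthogonal_matrix Q" "orthogonal_matrix R" "\<And>i. 0 < a i"
    "M = Q ** diag_matrix a ** R"
proof -
  have "transpose (transpose M ** M) = transpose M ** M" by (simp add: matrix_transpose_mul)
  then obtain R b where R: "orthogonal_matrix R" and b: "transpose M ** M = transpose R ** diag_matrix b ** R"
    using symmetric_matrix_diagonalizable by metis
  have RR: "R ** transpose R = mat 1" "transpose R ** R = mat 1"
    using R by (auto simp: orthogonal_matrix_def)
  have gram: "transpose (M ** transpose R) ** (M ** transpose R) = diag_matrix b"
  proof -
    have "transpose (M ** transpose R) ** (M ** transpose R) = R ** (transpose M ** M) ** transpose R"
      by (simp add: matrix_transpose_mul matrix_mul_assoc)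
    also have "\<dots> = (R ** transpose R) ** diag_matrix b ** (R ** transpose R)"
      unfolding b by (simp add: matrix_mul_assoc)
    finally show ?thesis by (simp add: RR)
  qed
  have bpos: "0 < b i" for i
  proof -
    let ?v = "(M ** transpose R) *v axis i 1"
    have "?v \<bullet> ?v = (axis i 1) \<bullet> (diag_matrix b *v axis i 1)"
      using norm_matrix_vector_sq[of "M ** transpose R" "axis i 1"] by (simp add: gram power2_norm_eq_inner)
    also have "\<dots> = b i" by (simp add: inner_axis' diag_matrix_vector)
    finally have "b i = ?v \<bullet> ?v" by simp
    moreover have "?v \<noteq> 0"
    proof
      assume "?v = 0"
      then have "(R ** matrix_inv M) *v ?v = 0" by simp
      then have "(R ** (matrix_inv M ** M) ** transpose R) *v axis i 1 = 0"
        by (simp add: matrix_vector_mul_assoc matrix_mul_assoc)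
      then show False using invertible_matrix_inv[OF assms] RR by (simp add: axis_eq_0_iff)
    qed
    ultimately show ?thesis by simp
  qed
  define a where "a i = sqrt (b i)" for i
  have a: "0 < a i" "a i * a i = b i" for i using bpos[of i] by (auto simp: a_def)
  have a_ne: "a i \<noteq> 0" for i using a(1)[of i] by simp
  define Q where "Q = M ** transpose R ** diag_matrix (\<lambda>i. 1 / a i)"
  have one: "diag_matrix (\<lambda>i. 1) = mat 1" using diag_matrix_const[of 1] by simp
  have "transpose Q ** Q = diag_matrix (\<lambda>i. 1 / a i) ** diag_matrix b ** diag_matrix (\<lambda>i. 1 / a i)"
    unfolding gram[symmetric] Q_def by (simp add: matrix_transpose_mul matrix_mul_assoc)
  also have "\<dots> = diag_matrix (\<lambda>i. 1)"
    unfolding diag_matrix_mult a(2)[symmetric] by (simp add: a_ne)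
  finally have Q: "orthogonal_matrix Q" by (simp add: orthogonal_matrix one)
  have "Q ** diag_matrix a ** R = M ** transpose R ** (diag_matrix (\<lambda>i. 1 / a i) ** diag_matrix a) ** R"
    by (simp add: Q_def matrix_mul_assoc)
  also have "diag_matrix (\<lambda>i. 1 / a i) ** diag_matrix a = mat 1"
    unfolding diag_matrix_mult one[symmetric]
    by (simp add: a_ne)
  also have "M ** transpose R ** mat 1 ** R = M ** (transpose R ** R)"
    by (simp add: matrix_mul_assoc)
  finally have "M = Q ** diag_matrix a ** R" by (simp add: RR)
  with that Q R a show thesis by blast
qed

section \<open>Averaging over irreducible groups\<close>

lemma scaleR_matrix_mult:
  fixes A :: "real^'n^'m" and B :: "real^'k^'n"
  shows "(c *\<^sub>R A) ** B = c *\<^sub>R (A ** B)" "A ** (c *\<^sub>R B) = c *\<^sub>R (A ** B)"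
  by (auto simp: matrix_matrix_mult_def vec_eq_iff sum_distrib_left mult_ac intro!: sum.cong)

lemma matrix_add_mult_distrib:
  fixes A B :: "real^'n^'m"
  shows "(A + B) ** C = A ** C + B ** (C :: real^'k^'n)"
  by (simp add: matrix_matrix_mult_def vec_eq_iff distrib_right sum.distrib)

lemma linear_matrix_mult:
  fixes A :: "real^'n^'m"
  shows "linear (\<lambda>B :: real^'k^'n. A ** B)" and "linear (\<lambda>B :: real^'m^'k. B ** A)"
  by (auto intro!: linearI simp: matrix_add_ldistrib matrix_add_mult_distrib scaleR_matrix_mult)

lemma linear_transpose: "linear (transpose :: real^'n^'m \<Rightarrow> real^'m^'n)"
  by (rule linearI) (auto simp: transpose_def vec_eq_iff)

lemma linear_trace: "linear (trace :: real^'n^'n \<Rightarrow> real)"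
  by (rule linearI) (auto simp: trace_def sum.distrib sum_distrib_left)

lemma continuous_on_matrix_mult [continuous_intros]:
  fixes f :: "'a::topological_space \<Rightarrow> real^'n^'m" and g :: "'a \<Rightarrow> real^'k^'n"
  assumes "continuous_on S f" "continuous_on S g"
  shows "continuous_on S (\<lambda>x. f x ** g x)"
  unfolding matrix_matrix_mult_def
  by (intro continuous_on_vec_lambda continuous_intros assms)

lemma continuous_on_transpose [continuous_intros]:
  fixes f :: "'a::topological_space \<Rightarrow> real^'n^'m"
  assumes "continuous_on S f"
  shows "continuous_on S (\<lambda>x. transpose (f x))"
  unfolding transpose_def
  by (intro continuous_on_vec_lambda continuous_intros assms)

lemma continuous_on_matrix_vector_mult [continuous_intros]:
  fixes f :: "'a::topological_space \<Rightarrow> real^'n^'m" and g :: "'a \<Rightarrow> real^'n"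
  assumes "continuous_on S f" "continuous_on S g"
  shows "continuous_on S (\<lambda>x. f x *v g x)"
  unfolding matrix_vector_mult_def
  by (intro continuous_on_vec_lambda continuous_intros assms)

text \<open>Schur's lemma for symmetric matrices. Symmetry supplies a real eigenvalue; its
  eigenspace is invariant under every matrix commuting with \<open>B\<close>, hence is the whole
  space, and the trace determines the eigenvalue.\<close>

lemma symmetric_commuting_irreducible:
  fixes B :: "real^'n^'n"
  assumes sym: "transpose B = B" and G: "irreducible_group G"
    and comm: "\<And>W. W \<in> G \<Longrightarrow> B ** W = W ** B"
  shows "B = (trace B / CARD('n)) *\<^sub>R mat 1"
proof -
  obtain v l where v: "norm v = 1" "B *v v = l *\<^sub>R v"
    by (rule selfadjoint_eigenvector_in_subspace[of "(*v) B" UNIV])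
      (auto simp: symmetric_matrix_inner[OF sym] UNIV_not_singleton)
  define E where "E = {x. B *v x = l *\<^sub>R x}"
  have "subspace E"
    by (auto simp: E_def subspace_def matrix_vector_right_distrib matrix_vector_mult_scaleR scaleR_right_distrib)
  moreover have "matrix_image W E \<subseteq> E" if "W \<in> G" for W
  proof -
    have "B *v (W *v x) = l *\<^sub>R (W *v x)" if "B *v x = l *\<^sub>R x" for x
    proof -
      have "B *v (W *v x) = W *v (B *v x)"
        using comm[OF \<open>W \<in> G\<close>] by (simp add: matrix_vector_mul_assoc)
      then show ?thesis using that by (simp add: matrix_vector_mult_scaleR)
    qed
    then show ?thesis by (auto simp: E_def matrix_image_def)
  qed
  moreover have "E \<noteq> {0}"
  proof
    assume "E = {0}"
    moreover have "v \<in> E" using v by (simp add: E_def)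
    ultimately show False using v by simp
  qed
  ultimately have "E = UNIV" using G unfolding irreducible_group_def by blast
  then have B: "B = l *\<^sub>R mat 1"
    unfolding matrix_eq by (simp add: E_def set_eq_iff flip: scaleR_matrix_vector_assoc)
  then have "trace B = l * CARD('n)" by (simp add: trace_def mat_def)
  then show ?thesis using B by simp
qed

text \<open>The point of minimal norm of the convex hull is unique, hence fixed by conjugation with the
  group, hence scalar by irreducibility.  This replaces averaging with respect to Haar measure.\<close>

lemma convex_hull_conjugates_contains_scalar:
  fixes P :: "real^'n^'n" and G :: "(real^'n^'n) set"
  assumes sym: "transpose P = P" and G: "orthogonal_matrix_group G" "irreducible_group G" and cpt: "compact G"
  shows "(trace P / CARD('n)) *\<^sub>R mat 1 \<in> convex hull ((\<lambda>U. transpose U ** P ** U) ` G)"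
proof -
  define C where "C = (\<lambda>U. transpose U ** P ** U) ` G"
  define H where "H = convex hull C"
  have Gmul: "U ** W \<in> G" if "U \<in> G" "W \<in> G" for U W
    using that G by (auto simp: orthogonal_matrix_group_def)
  have Gorth: "orthogonal_matrix U" if "U \<in> G" for U
    using that G by (auto simp: orthogonal_matrix_group_def)
  have "mat 1 \<in> G" using G by (auto simp: orthogonal_matrix_group_def)
  then have Hne: "H \<noteq> {}" by (auto simp: H_def C_def)
  have "compact C" unfolding C_def by (intro compact_continuous_image continuous_intros cpt)
  then have Hcl: "closed H" unfolding H_def by (intro compact_imp_closed compact_convex_hull)
  define B where "B = closest_point H 0"
  have BH: "B \<in> H" unfolding B_def using Hcl Hne by (rule closest_point_in_set)
  \<comment> \<open>Both properties hold for the conjugates and pass to the hull: symmetry is what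
    Schur's lemma needs, and the trace identifies the scalar.\<close>
  have "H \<subseteq> {A. transpose A = A \<and> trace A = trace P}"
    unfolding H_def
  proof (rule hull_minimal)
    have "transpose (transpose U ** P ** U) = transpose U ** P ** U" for U
      by (simp add: matrix_transpose_mul sym matrix_mul_assoc)
    moreover have "trace (transpose U ** P ** U) = trace P" if "U \<in> G" for U
    proof -
      have "trace (transpose U ** P ** U) = trace (U ** (transpose U ** P))" by (rule trace_mul_sym)
      then show ?thesis using Gorth[OF that] by (simp add: matrix_mul_assoc orthogonal_matrix_def)
    qed
    ultimately show "C \<subseteq> {A. transpose A = A \<and> trace A = trace P}"
      by (auto simp: C_def)
    show "convex {A :: real^'n^'n. transpose A = A \<and> trace A = trace P}"
      unfolding convex_def
    proof safe
      fix X Y :: "real^'n^'n" and u v :: real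
      assume *: "u + v = 1" "transpose X = X" "transpose Y = Y" "trace X = trace P" "trace Y = trace P"
      show "transpose (u *\<^sub>R X + v *\<^sub>R Y) = u *\<^sub>R X + v *\<^sub>R Y"
        by (simp add: * linear_add[OF linear_transpose] linear_scale[OF linear_transpose])
      show "trace (u *\<^sub>R X + v *\<^sub>R Y) = trace P"
        by (simp add: * linear_add[OF linear_trace] linear_scale[OF linear_trace] flip: distrib_right)
    qed
  qed
  then have Bs: "transpose B = B" "trace B = trace P" using BH by auto
  have "B ** W = W ** B" if W: "W \<in> G" for W
  proof -
    let ?f = "\<lambda>A. transpose W ** A ** W"
    have lin: "linear ?f"
      using linear_compose[OF linear_matrix_mult(1)[of "transpose W"] linear_matrix_mult(2)[of W]]
      by (simp add: o_def)
    \<comment> \<open>Conjugation by \<open>W\<close> replaces \<open>U\<close> by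
      \<open>U ** W\<close>, so \<open>C\<close>, and by linearity its hull, is mapped into
      itself.\<close>
    have "?f ` H = convex hull (?f ` C)" unfolding H_def by (rule convex_hull_linear_image[OF lin])
    also have "\<dots> \<subseteq> H" unfolding H_def
    proof (rule hull_mono)
      have "?f (transpose U ** P ** U) = transpose (U ** W) ** P ** (U ** W)" for U
        by (simp add: matrix_transpose_mul matrix_mul_assoc)
      then show "?f ` C \<subseteq> C" using Gmul[OF _ W] by (auto simp: C_def)
    qed
    finally have fB: "?f B \<in> H" using BH by blast
    have "norm (?f B) = norm B"
      using Gorth[OF W] by (simp add: norm_orthogonal_mult)
    then have "\<forall>z\<in>H. dist 0 (?f B) \<le> dist 0 z"
      using closest_point_le[OF Hcl, of _ 0] by (simp add: B_def)
    moreover have "convex H" by (simp add: H_def)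
    ultimately have "?f B = B"
      unfolding B_def[symmetric] using closest_point_unique[OF _ Hcl fB, of 0] by (metis B_def)
    then have "W ** B = W ** (transpose W ** B ** W)" by simp
    also have "\<dots> = (W ** transpose W) ** B ** W" by (simp add: matrix_mul_assoc)
    finally show ?thesis using Gorth[OF W] by (simp add: orthogonal_matrix_def)
  qed
  from symmetric_commuting_irreducible[OF Bs(1) G(2) this] Bs(2) BH show ?thesis
    by (simp add: H_def C_def)
qed

text \<open>The conjugates of \<open>transpose A ** A\<close> are the matrices of the quadratic
  forms \<open>(norm (A *v (U *v x)))^2\<close>, and a scalar matrix lies in their convex hull. The
  index set consists of the conjugates that occur in the combination; \<open>U\<close> picks a group
  element for each.\<close>

lemma irreducible_group_average:
  fixes A :: "real^'n^'n" and G :: "(real^'n^'n) set"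
  assumes G: "orthogonal_matrix_group G" "irreducible_group G" and cpt: "compact G"
  obtains I :: "(real^'n^'n) set" and w U where "finite I" "\<And>i. i \<in> I \<Longrightarrow> 0 < w i" "sum w I = 1"
    "\<And>i. i \<in> I \<Longrightarrow> U i \<in> G"
    "\<And>x. (\<Sum>i\<in>I. w i * (norm (A *v (U i *v x)))\<^sup>2) = (norm A)\<^sup>2 / CARD('n) * (norm x)\<^sup>2"
proof -
  let ?P = "transpose A ** A"
  let ?f = "\<lambda>U. transpose U ** ?P ** U"
  have "(trace ?P / CARD('n)) *\<^sub>R mat 1 \<in> convex hull (?f ` G)"
    by (rule convex_hull_conjugates_contains_scalar[OF _ G cpt]) (simp add: matrix_transpose_mul)
  then obtain S u where S: "finite S" "S \<subseteq> ?f ` G" "\<forall>x\<in>S. 0 \<le> u x" "sum u S = 1"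
      and eq: "(\<Sum>v\<in>S. u v *\<^sub>R v) = (trace ?P / CARD('n)) *\<^sub>R mat 1"
    unfolding convex_hull_explicit by blast
  have "\<forall>v\<in>S. \<exists>U\<in>G. v = ?f U" using S(2) by blast
  then obtain U where U: "\<And>v. v \<in> S \<Longrightarrow> U v \<in> G" "\<And>v. v \<in> S \<Longrightarrow> v = ?f (U v)" by metis
  \<comment> \<open>Points of weight zero are dropped: the later strictness argument needs a
    positive weight at every index.\<close>
  define I where "I = {v\<in>S. 0 < u v}"
  have zero: "u v = 0" if "v \<in> S - I" for v using that S(3) by (auto simp: I_def)
  have I: "I \<subseteq> S" "finite I" using S(1) by (auto simp: I_def)
  show thesis
  proof (rule that[of I u U])
    show "sum u I = 1" using sum.mono_neutral_left[OF S(1) I(1), of u] zero S(4) by simp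
    show "(\<Sum>i\<in>I. u i * (norm (A *v (U i *v x)))\<^sup>2) = (norm A)\<^sup>2 / CARD('n) * (norm x)\<^sup>2" for x
    proof -
      have "(norm (A *v (U v *v x)))\<^sup>2 = x \<bullet> (v *v x)" if "v \<in> S" for v
      proof -
        have "A *v (U v *v x) = (A ** U v) *v x" by (simp add: matrix_vector_mul_assoc)
        moreover have "transpose (A ** U v) ** (A ** U v) = v"
          using U(2)[OF that] by (simp add: matrix_transpose_mul matrix_mul_assoc)
        ultimately show ?thesis using norm_matrix_vector_sq[of "A ** U v" x] by simp
      qed
      then have "(\<Sum>i\<in>I. u i * (norm (A *v (U i *v x)))\<^sup>2) = (\<Sum>v\<in>I. u v * (x \<bullet> (v *v x)))"
        using I(1) by (intro sum.cong) auto
      also have "\<dots> = (\<Sum>v\<in>S. u v * (x \<bullet> (v *v x)))"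
        using zero by (intro sum.mono_neutral_left S(1) I(1)) auto
      also have "\<dots> = x \<bullet> ((\<Sum>v\<in>S. u v *\<^sub>R v) *v x)"
      proof -
        have lin: "linear (\<lambda>B :: real^'n^'n. x \<bullet> (B *v x))"
          by (rule linearI) (auto simp: matrix_vector_mult_add_rdistrib inner_add_right
              scaleR_matrix_vector_assoc[symmetric])
        show ?thesis
          using linear_sum[OF lin, of "\<lambda>v. u v *\<^sub>R v" S] by (simp add: linear_scale[OF lin])
      qed
      also have "\<dots> = trace ?P / CARD('n) * (norm x)\<^sup>2"
        unfolding eq by (simp add: scaleR_matrix_vector_assoc[symmetric] power2_norm_eq_inner)
      finally show ?thesis by (simp add: norm_matrix_sq)
    qed
  qed (use I U in \<open>auto simp: I_def\<close>)
qed

text \<open>The irreducible group given by hypothesis need not be closed. The full isometry group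
  contains it, so it is irreducible as well, and it is compact when \<open>K\<close> is, as the
  averaging requires.\<close>

definition isometry_group :: "(real^'n) set \<Rightarrow> (real^'n^'n) set" where
  "isometry_group K = {U. isometry_of U K}"

lemma matrix_image_mult: "matrix_image (A ** B) K = matrix_image A (matrix_image B K)"
  by (simp add: matrix_image_def image_image matrix_vector_mul_assoc)

lemma matrix_image_mat_1 [simp]: "matrix_image (mat 1) K = K"
  by (simp add: matrix_image_def)

lemma orthogonal_matrix_inv: "orthogonal_matrix (U :: real^'n^'n) \<Longrightarrow> matrix_inv U = transpose U"
proof -
  assume U: "orthogonal_matrix U"
  then have "invertible U" by (auto simp: invertible_def orthogonal_matrix_def)
  then have "matrix_inv U ** (U ** transpose U) = mat 1 ** transpose U"
    by (simp only: matrix_mul_assoc invertible_matrix_inv)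
  then show ?thesis using U by (simp add: orthogonal_matrix_def)
qed

text \<open>For closed \<open>K\<close> each of these conditions is visibly closed in
  \<open>U\<close>, unlike the equation \<open>matrix_image U K = K\<close>.\<close>

lemma isometry_group_alt:
  fixes K :: "(real^'n) set"
  shows "isometry_group K = {U. transpose U ** U = mat 1 \<and> matrix_image U K \<subseteq> K \<and> matrix_image (transpose U) K \<subseteq> K}"
proof -
  have "matrix_image U K = K \<longleftrightarrow> matrix_image U K \<subseteq> K \<and> matrix_image (transpose U) K \<subseteq> K"
    if "orthogonal_matrix U" for U :: "real^'n^'n"
  proof -
    have "matrix_image U (matrix_image (transpose U) K) = K"
      "matrix_image (transpose U) (matrix_image U K) = K"
      using that by (simp_all add: orthogonal_matrix_def flip: matrix_image_mult)
    moreover have "matrix_image U A \<subseteq> matrix_image U B" if "A \<subseteq> B" for A B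
      using that by (auto simp: matrix_image_def)
    ultimately show ?thesis by (metis order_refl subset_antisym)
  qed
  then show ?thesis by (auto simp: isometry_group_def isometry_of_def orthogonal_matrix)
qed

lemma isometry_group_group: "orthogonal_matrix_group (isometry_group K)"
  unfolding orthogonal_matrix_group_def
proof (intro conjI ballI)
  fix U W assume "U \<in> isometry_group K" "W \<in> isometry_group K"
  then show "U ** W \<in> isometry_group K"
    by (simp add: isometry_group_def isometry_of_def orthogonal_matrix_mul matrix_image_mult)
next
  fix U assume U: "U \<in> isometry_group K"
  then have "matrix_inv U = transpose U"
    by (simp add: isometry_group_def isometry_of_def orthogonal_matrix_inv)
  then show "matrix_inv U \<in> isometry_group K"
    using U by (auto simp: isometry_group_alt intro: matrix_left_right_inverse[THEN iffD1])
qed (auto simp: isometry_group_def isometry_of_def orthogonal_matrix_id)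

lemma isometry_group_irreducible:
  assumes "has_irreducible_isometry_group K"
  shows "irreducible_group (isometry_group K)"
proof -
  obtain G where G: "\<forall>U\<in>G. isometry_of U K" "irreducible_group G"
    using assms by (auto simp: has_irreducible_isometry_group_def)
  then have "G \<subseteq> isometry_group K" by (auto simp: isometry_group_def)
  then show ?thesis using G(2) unfolding irreducible_group_def by (metis subsetD)
qed

lemma compact_isometry_group:
  assumes "compact K"
  shows "compact (isometry_group (K :: (real^'n) set))"
proof -
  have K: "closed K" using assms by (rule compact_imp_closed)
  have "isometry_group K = {U. transpose U ** U = mat 1} \<inter> (\<Inter>x\<in>K. (\<lambda>U. U *v x) -` K \<inter> (\<lambda>U. transpose U *v x) -` K)"
    by (auto simp: isometry_group_alt matrix_image_def)
  also have "closed \<dots>"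
    by (intro closed_Int closed_INT ballI closed_Collect_eq closed_vimage continuous_intros K)
  finally have "closed (isometry_group K)" .
  moreover have "bounded (isometry_group K)"
    unfolding bounded_iff
  proof (intro exI ballI)
    fix U assume "U \<in> isometry_group K"
    then have "(norm U)\<^sup>2 = real CARD('n)"
      by (simp add: isometry_group_alt norm_matrix_sq) (simp add: trace_def mat_def)
    then show "norm U \<le> sqrt (real CARD('n))" by (simp add: real_le_rsqrt)
  qed
  ultimately show ?thesis by (simp add: compact_eq_bounded_closed)
qed

section \<open>Linear change of variables\<close>

text \<open>Compare the two translation-invariant measures by Fubini; the constant is read off the unit ball.\<close>

lemma lborel_orthogonal_transformation:
  fixes U :: "'a::euclidean_space \<Rightarrow> 'a"
  assumes U: "orthogonal_transformation U"
  shows "distr lborel borel U = lborel"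
proof (rule measure_eqI)
  have lin: "linear U" using U by (rule orthogonal_transformation_linear)
  have Ucont: "continuous_on UNIV U" using lin by (intro linear_continuous_on) (simp add: linear_conv_bounded_linear)
  then have [measurable]: "U \<in> borel_measurable borel" by (rule borel_measurable_continuous_onI)
  fix A assume "A \<in> sets (distr lborel borel U)"
  then have [measurable]: "A \<in> sets borel" by simp
  define E where "E = ball (0::'a) 1"
  have [measurable]: "E \<in> sets borel" by (simp add: E_def)
  have UE: "U -` E = E" using orthogonal_transformation_norm[OF U] by (auto simp: E_def)
  let ?m = "emeasure lborel"
  have shift: "(\<integral>\<^sup>+ y. f (y + c) \<partial>lborel) = (\<integral>\<^sup>+ y. f y \<partial>lborel)"
    if [measurable]: "f \<in> borel_measurable borel" for f :: "'a \<Rightarrow> ennreal" and c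
    by (subst (2) lborel_affine[of 1 c]) (simp_all add: nn_integral_density nn_integral_distr add.commute density_1)
  have reflect: "(\<integral>\<^sup>+ y. f (c - y) \<partial>lborel) = (\<integral>\<^sup>+ y. f y \<partial>lborel)"
    if [measurable]: "f \<in> borel_measurable borel" for f :: "'a \<Rightarrow> ennreal" and c
    by (subst (2) lborel_affine[of "-1" c]) (simp_all add: nn_integral_density nn_integral_distr density_1)
  have preimage: "(\<integral>\<^sup>+ x. indicator B (U x) \<partial>lborel) = ?m (U -` B)" if "B \<in> sets borel" for B
  proof -
    have "U -` B \<in> sets borel" by (rule measurable_sets_borel[OF _ that]) measurable
    then have "?m (U -` B) = (\<integral>\<^sup>+ x. indicator (U -` B) x \<partial>lborel)" by simp
    then show ?thesis by (simp add: indicator_def)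
  qed
  \<comment> \<open>The double integral of \<open>indicator A (U x) * indicator E y\<close> is
    computed in two ways. Substituting in turn for \<open>y\<close>, \<open>x\<close> and
    \<open>y\<close> exchanges the roles of \<open>A\<close> and \<open>E\<close>, and the ball
    \<open>E\<close> is preserved by \<open>U\<close>.\<close>
  have "?m (U -` A) * ?m E = (\<integral>\<^sup>+ x. indicator A (U x) * (\<integral>\<^sup>+ y. indicator E y \<partial>lborel) \<partial>lborel)"
    by (simp add: nn_integral_multc preimage)
  also have "\<dots> = (\<integral>\<^sup>+ x. (\<integral>\<^sup>+ y. indicator A (U x) * indicator E (y + U x) \<partial>lborel) \<partial>lborel)"
    by (simp add: nn_integral_cmult shift)
  also have "\<dots> = (\<integral>\<^sup>+ y. (\<integral>\<^sup>+ x. indicator A (U x) * indicator E (y + U x) \<partial>lborel) \<partial>lborel)"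
    by (rule lborel_pair.Fubini') measurable
  also have "\<dots> = (\<integral>\<^sup>+ y. (\<integral>\<^sup>+ x. indicator A (U x - y) * indicator E (U x) \<partial>lborel) \<partial>lborel)"
  \<comment> \<open>Translating \<open>x\<close> by the preimage \<open>c\<close> of
    \<open>- y\<close> moves \<open>y\<close> from the second indicator to the first.\<close>
  proof (rule nn_integral_cong)
    fix y
    obtain c where c: "U c = - y" using orthogonal_transformation_surj[OF U] by (metis surjD)
    have "(\<integral>\<^sup>+ x. indicator A (U x) * indicator E (y + U x) \<partial>lborel)
        = (\<integral>\<^sup>+ x. indicator A (U (x + c)) * indicator E (y + U (x + c)) \<partial>lborel)"
      by (subst shift) (simp_all)
    then show "(\<integral>\<^sup>+ x. indicator A (U x) * indicator E (y + U x) \<partial>lborel)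
        = (\<integral>\<^sup>+ x. indicator A (U x - y) * indicator E (U x) \<partial>lborel)"
      by (simp add: linear_add[OF lin] c)
  qed
  also have "\<dots> = (\<integral>\<^sup>+ x. (\<integral>\<^sup>+ y. indicator A (U x - y) * indicator E (U x) \<partial>lborel) \<partial>lborel)"
    by (rule lborel_pair.Fubini') measurable
  also have "\<dots> = (\<integral>\<^sup>+ x. ?m A * indicator E (U x) \<partial>lborel)"
    by (simp add: nn_integral_multc reflect)
  also have "\<dots> = ?m A * ?m (U -` E)"
    by (simp add: nn_integral_cmult preimage)
  finally have "?m (U -` A) * ?m E = ?m A * ?m E" unfolding UE .
  moreover have "?m E \<noteq> 0" "?m E < \<infinity>"
    using unit_ball_vol_pos[of "real DIM('a)", THEN less_imp_neq]
    by (auto simp: E_def emeasure_ball emeasure_lborel_ball_finite simp del: unit_ball_vol_pos)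
  ultimately have "?m (U -` A) = ?m A"
    by (auto simp: ennreal_mult_cancel_left mult.commute[of _ "?m E"])
  then show "emeasure (distr lborel borel U) A = ?m A"
    by (simp add: emeasure_distr)
qed simp

lemma borel_measurable_matrix_vector [measurable]:
  "(\<lambda>x. (M :: real^'n^'m) *v x) \<in> borel_measurable borel"
  by (intro borel_measurable_continuous_onI continuous_intros)

lemma lborel_diag_matrix:
  assumes d: "\<And>i. 0 < d i"
  shows "lborel = density (distr lborel borel ((*v) (diag_matrix d :: real^'n^'n))) (\<lambda>_. ennreal (\<Prod>i\<in>UNIV. d i))"
proof -
  \<comment> \<open>\<open>lborel_affine_euclidean\<close> expects the scaling factors as a function
    of basis vectors; this linear function takes the value \<open>d i\<close> at
    \<open>axis i 1\<close>.\<close>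
  define c :: "real^'n \<Rightarrow> real" where "c b = (\<Sum>i\<in>UNIV. d i * b $ i)" for b
  have c: "c (axis i 1) = d i" for i
    by (simp add: c_def axis_def mult_delta_right)
  have basis: "(Basis :: (real^'n) set) = range (\<lambda>i. axis i 1)"
    by (auto simp: Basis_vec_def)
  have inj: "inj (\<lambda>i :: 'n. axis i (1::real))" by (auto intro!: injI simp: axis_eq_axis)
  have T: "(0 + (\<Sum>j\<in>Basis. (c j * (x \<bullet> j)) *\<^sub>R j)) = diag_matrix d *v x" for x
  proof -
    have "(\<Sum>j\<in>Basis. (c j * (x \<bullet> j)) *\<^sub>R j) = (\<Sum>i\<in>UNIV. (d i * x $ i) *\<^sub>R axis i 1)"
      unfolding basis by (simp add: sum.reindex[OF inj] c inner_axis)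
    then show ?thesis
      by (simp add: vec_eq_iff diag_matrix_vector axis_def mult_delta_right)
  qed
  have "lborel = density (distr lborel borel (\<lambda>x. 0 + (\<Sum>j\<in>Basis. (c j * (x \<bullet> j)) *\<^sub>R j)))
      (\<lambda>_. ennreal (\<Prod>j\<in>Basis. \<bar>c j\<bar>))"
    by (rule lborel_affine_euclidean) (use d in \<open>auto simp: basis c less_imp_neq[symmetric]\<close>)
  also have "(\<Prod>j\<in>Basis. \<bar>c j\<bar>) = (\<Prod>i\<in>UNIV. d i)"
    unfolding basis by (simp add: prod.reindex[OF inj] c abs_of_pos d)
  finally show ?thesis unfolding T .
qed

lemma lborel_orthogonal_matrix:
  assumes "orthogonal_matrix (Q :: real^'n^'n)"
  shows "distr lborel borel ((*v) Q) = lborel"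
  by (rule lborel_orthogonal_transformation)
     (simp add: orthogonal_transformation assms orthogonal_matrix_norm)

lemma abs_det_orthogonal: "orthogonal_matrix (Q :: real^'n^'n) \<Longrightarrow> \<bar>det Q\<bar> = 1"
  using det_orthogonal_matrix[of Q] by auto

text \<open>\<open>measure_linear_image\<close> covers only index types of class \<open>wellorder\<close>.\<close>

lemma lborel_linear_image:
  fixes M :: "real^'n^'n"
  assumes "invertible M"
  shows "lborel = density (distr lborel borel ((*v) M)) (\<lambda>_. ennreal \<bar>det M\<bar>)"
proof -
  obtain Q R a where QR: "orthogonal_matrix Q" "orthogonal_matrix R" and a: "\<And>i. 0 < a i"
    and M: "M = Q ** diag_matrix a ** R"
    using singular_value_decomposition[OF assms] by blast
  let ?D = "diag_matrix a :: real^'n^'n"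
  have det: "\<bar>det M\<bar> = (\<Prod>i\<in>UNIV. a i)"
    using abs_det_orthogonal[OF QR(1)] abs_det_orthogonal[OF QR(2)] a
    by (simp add: M det_mul det_diag_matrix abs_mult abs_of_pos prod_pos)
  \<comment> \<open>\<open>R\<close> acts first, on a measure that it preserves, and disappears. The
    formula for \<open>?D\<close> is then pushed forward by \<open>Q\<close>, which preserves
    \<open>lborel\<close> too.\<close>
  have "distr lborel borel ((*v) M) = distr (distr lborel borel ((*v) R)) borel ((*v) (Q ** ?D))"
    by (subst distr_distr) (simp_all add: M o_def matrix_vector_mul_assoc)
  also have "\<dots> = distr (distr lborel borel ((*v) ?D)) borel ((*v) Q)"
    by (subst distr_distr) (simp_all add: lborel_orthogonal_matrix[OF QR(2)] o_def matrix_vector_mul_assoc)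
  finally have eq: "distr lborel borel ((*v) M) = distr (distr lborel borel ((*v) ?D)) borel ((*v) Q)" .
  have "lborel = distr lborel borel ((*v) Q)" using lborel_orthogonal_matrix[OF QR(1)] by simp
  also have "\<dots> = distr (density (distr lborel borel ((*v) ?D)) (\<lambda>_. ennreal (\<Prod>i\<in>UNIV. a i))) borel ((*v) Q)"
    using lborel_diag_matrix[of a, OF a] by simp
  also have "\<dots> = density (distr (distr lborel borel ((*v) ?D)) borel ((*v) Q)) (\<lambda>_. ennreal (\<Prod>i\<in>UNIV. a i))"
  proof (intro measure_eqI)
    fix A assume "A \<in> sets (distr (density (distr lborel borel ((*v) ?D)) (\<lambda>_. ennreal (\<Prod>i\<in>UNIV. a i))) borel ((*v) Q))"
    then have A: "A \<in> sets borel" by simp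
    have "(*v) Q -` A \<in> sets borel" by (rule measurable_sets_borel[OF _ A]) measurable
    then show "emeasure (distr (density (distr lborel borel ((*v) ?D)) (\<lambda>_. ennreal (\<Prod>i\<in>UNIV. a i))) borel ((*v) Q)) A
        = emeasure (density (distr (distr lborel borel ((*v) ?D)) borel ((*v) Q)) (\<lambda>_. ennreal (\<Prod>i\<in>UNIV. a i))) A"
      using A by (simp add: emeasure_density_const emeasure_distr[of _ _ borel])
  qed simp
  finally show ?thesis unfolding eq det .
qed

lemma matrix_image_vimage:
  assumes "invertible (M :: real^'n^'n)"
  shows "(*v) M -` matrix_image M K = K"
proof -
  have "inj ((*v) M)"
    by (rule inj_on_inverseI[of _ "(*v) (matrix_inv M)"]) (simp add: matrix_vector_mul_assoc invertible_matrix_inv[OF assms])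
  then show ?thesis by (simp add: matrix_image_def inj_vimage_image_eq)
qed

lemma compact_matrix_image: "compact K \<Longrightarrow> compact (matrix_image M K)"
  unfolding matrix_image_def by (intro compact_continuous_image continuous_intros)

text \<open>Compactness of \<open>K\<close> and continuity of \<open>f\<close> make the sets and the
  integrands Borel, so the completed measure can be traded for \<open>lborel\<close>, where the
  density formula applies.\<close>

lemma set_lebesgue_integral_matrix_image:
  fixes M :: "real^'n^'n" and f :: "real^'n \<Rightarrow> 'b::euclidean_space"
  assumes M: "invertible M" and K: "compact K" and f: "continuous_on UNIV f"
  shows "(LINT x:matrix_image M K|lebesgue. f x) = \<bar>det M\<bar> *\<^sub>R (LINT x:K|lebesgue. f (M *v x))"
proof -
  let ?K = "matrix_image M K"
  have [measurable]: "K \<in> sets borel" "?K \<in> sets borel"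
    using K compact_matrix_image[OF K, of M] by (auto intro: borel_compact)
  have [measurable]: "f \<in> borel_measurable borel" using f by (rule borel_measurable_continuous_onI)
  have ind: "indicator ?K (M *v x) = (indicator K x :: real)" for x
    using matrix_image_vimage[OF M, of K] by (auto simp: indicator_def)
  have "(LINT x:?K|lebesgue. f x) = (LINT x|lborel. indicator ?K x *\<^sub>R f x)"
    unfolding set_lebesgue_integral_def by (rule integral_completion) measurable
  also have "\<dots> = (LINT x|density (distr lborel borel ((*v) M)) (\<lambda>_. ennreal \<bar>det M\<bar>). indicator ?K x *\<^sub>R f x)"
    by (simp flip: lborel_linear_image[OF M])
  also have "\<dots> = (LINT x|lborel. \<bar>det M\<bar> *\<^sub>R (indicator K x *\<^sub>R f (M *v x)))"
    by (subst integral_density) (auto simp: integral_distr ind)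
  also have "\<dots> = \<bar>det M\<bar> *\<^sub>R (LINT x|lborel. indicator K x *\<^sub>R f (M *v x))"
    by (rule integral_scaleR_right)
  also have "(LINT x|lborel. indicator K x *\<^sub>R f (M *v x)) = (LINT x:K|lebesgue. f (M *v x))"
    unfolding set_lebesgue_integral_def by (rule integral_completion[symmetric]) measurable
  finally show ?thesis .
qed

section \<open>Riesz energy\<close>

lemma measurable_riesz_kernel [measurable]:
  fixes f g :: "'b \<Rightarrow> 'a::euclidean_space"
  assumes [measurable]: "f \<in> borel_measurable M" "g \<in> borel_measurable M"
  shows "(\<lambda>x. riesz_kernel p (f x) (g x)) \<in> borel_measurable M"
  unfolding riesz_kernel_def by measurable

lemma riesz_kernel_eq:
  assumes "x \<noteq> y"
  shows "riesz_kernel p x y = ennreal (norm (x - y) powr - p)"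
proof -
  have "0 < norm (x - y) powr p" using assms by simp
  then show ?thesis
    by (simp add: riesz_kernel_def divide_ennreal[of 1, simplified] powr_minus_divide)
qed

lemma riesz_kernel_diag [simp]: "riesz_kernel p x x = \<infinity>"
  by (simp add: riesz_kernel_def divide_ennreal_def)

lemma borel_prob_measures_onD:
  assumes "\<mu> \<in> borel_prob_measures_on K"
  shows "prob_space \<mu>" "space \<mu> = K" "f \<in> borel_measurable borel \<Longrightarrow> f \<in> borel_measurable \<mu>"
proof -
  have \<mu>: "prob_space \<mu>" "sets \<mu> = sets (restrict_space borel K)"
    using assms by (auto simp: borel_prob_measures_on_def)
  show "prob_space \<mu>" by fact
  show "space \<mu> = K" using sets_eq_imp_space_eq[OF \<mu>(2)] by (simp add: space_restrict_space)
  show "f \<in> borel_measurable \<mu>" if "f \<in> borel_measurable borel"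
    using measurable_restrict_space1[OF that] measurable_cong_sets[OF \<mu>(2) refl] by blast
qed

lemma riesz_energy_image_le:
  fixes K :: "'a::euclidean_space set" and L :: "'b::euclidean_space set"
  assumes \<mu>: "\<mu> \<in> borel_prob_measures_on K"
    and f: "f \<in> borel_measurable borel" "f ` K \<subseteq> L"
  shows "riesz_energy p L \<le> (\<integral>\<^sup>+ y. (\<integral>\<^sup>+ x. riesz_kernel p (f x) (f y) \<partial>\<mu>) \<partial>\<mu>)"
proof -
  interpret prob_space \<mu> using borel_prob_measures_onD[OF \<mu>] by simp
  define \<nu> where "\<nu> = distr \<mu> (restrict_space borel L) f"
  have f\<mu>: "f \<in> borel_measurable \<mu>" by (rule borel_prob_measures_onD(3)[OF \<mu> f(1)])
  then have fL [measurable]: "f \<in> \<mu> \<rightarrow>\<^sub>M restrict_space borel L"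
    using f(2) borel_prob_measures_onD(2)[OF \<mu>] by (intro measurable_restrict_space2) auto
  have \<nu>: "\<nu> \<in> borel_prob_measures_on L"
    unfolding borel_prob_measures_on_def \<nu>_def by (auto intro: prob_space_distr)
  interpret \<nu>: prob_space \<nu> using borel_prob_measures_onD[OF \<nu>] by simp
  have [measurable]: "(\<lambda>x. x) \<in> borel_measurable \<nu>" "(\<lambda>x. x) \<in> borel_measurable (restrict_space borel L)"
    by (auto intro: borel_prob_measures_onD(3)[OF \<nu>] measurable_restrict_space1)
  have "riesz_energy p L \<le> (\<integral>\<^sup>+ y. (\<integral>\<^sup>+ x. riesz_kernel p x y \<partial>\<nu>) \<partial>\<nu>)"
    unfolding riesz_energy_def by (rule INF_lower[OF \<nu>])
  also have "\<dots> = (\<integral>\<^sup>+ y. (\<integral>\<^sup>+ x. riesz_kernel p x (f y) \<partial>\<nu>) \<partial>\<mu>)"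
    unfolding \<nu>_def
  proof (rule nn_integral_distr[OF fL])
    have "(\<lambda>y. \<integral>\<^sup>+ x. riesz_kernel p x y \<partial>\<nu>) \<in> borel_measurable \<nu>"
      by measurable
    then show "(\<lambda>y. \<integral>\<^sup>+ x. riesz_kernel p x y \<partial>distr \<mu> (restrict_space borel L) f)
        \<in> borel_measurable (distr \<mu> (restrict_space borel L) f)" by (simp add: \<nu>_def)
  qed
  also have "\<dots> = (\<integral>\<^sup>+ y. (\<integral>\<^sup>+ x. riesz_kernel p (f x) (f y) \<partial>\<mu>) \<partial>\<mu>)"
    unfolding \<nu>_def by (intro nn_integral_cong nn_integral_distr[OF fL]) measurable
  finally show ?thesis .
qed

text \<open>Test measures on the image: push-forwards of measures on \<open>K\<close> by \<open>M\<close> composed with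
  isometries of \<open>K\<close>.\<close>

lemma riesz_energy_linear_image_le:
  fixes M :: "real^'n^'n" and w :: "'i \<Rightarrow> real"
  assumes M: "invertible M" and I: "finite I" "\<And>i. i \<in> I \<Longrightarrow> 0 < w i" "sum w I = 1"
    and U: "\<And>i. i \<in> I \<Longrightarrow> U i \<in> isometry_group K" and C: "0 < C"
    and le: "\<And>z. z \<noteq> 0 \<Longrightarrow> (\<Sum>i\<in>I. w i * norm (M *v (U i *v z)) powr - p) \<le> C * norm z powr - p"
  shows "riesz_energy p (matrix_image M K) \<le> ennreal C * riesz_energy p K"
proof -
  let ?E = "riesz_energy p (matrix_image M K)"
  \<comment> \<open>\<open>C\<close> is moved to the left side, where a lower bound for every
    competitor bounds the infimum directly; at the end it is moved back.\<close>
  have cancel: "ennreal C * (ennreal (1 / C) * e) = e" "ennreal (1 / C) * (ennreal C * e) = e" for e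
    using C by (simp_all flip: mult.assoc ennreal_mult)
  have "ennreal (1 / C) * ?E \<le> (\<integral>\<^sup>+ y. (\<integral>\<^sup>+ x. riesz_kernel p x y \<partial>\<mu>) \<partial>\<mu>)"
    if \<mu>: "\<mu> \<in> borel_prob_measures_on K" for \<mu>
  proof -
    interpret prob_space \<mu> using borel_prob_measures_onD[OF \<mu>] by simp
    have lin [measurable]: "(\<lambda>x. A *v x) \<in> borel_measurable \<mu>" for A :: "real^'n^'n"
      by (intro borel_prob_measures_onD(3)[OF \<mu>] borel_measurable_continuous_onI continuous_intros)
    have [measurable]: "(\<lambda>x. x) \<in> borel_measurable \<mu>"
      by (intro borel_prob_measures_onD(3)[OF \<mu>]) simp
    let ?k = "\<lambda>i x y. riesz_kernel p (M *v (U i *v x)) (M *v (U i *v y))"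
    have km [measurable]: "(\<lambda>(y, x). ?k i x y) \<in> borel_measurable (\<mu> \<Otimes>\<^sub>M \<mu>)" for i
      unfolding matrix_vector_mul_assoc by measurable
    have km1 [measurable]: "(\<lambda>x. ?k i x y) \<in> borel_measurable \<mu>" for i y
      unfolding matrix_vector_mul_assoc by measurable
    \<comment> \<open>The energy of the image is written as a weighted average of itself, so that
      each copy can be tested with its own push-forward.\<close>
    have "?E = (\<Sum>i\<in>I. ennreal (w i)) * ?E"
      using I by (subst sum_ennreal) (auto simp: less_imp_le)
    also have "\<dots> = (\<Sum>i\<in>I. ennreal (w i) * ?E)" by (rule sum_distrib_right)
    also have "\<dots> \<le> (\<Sum>i\<in>I. ennreal (w i) * (\<integral>\<^sup>+ y. (\<integral>\<^sup>+ x. ?k i x y \<partial>\<mu>) \<partial>\<mu>))"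
    proof (intro sum_mono mult_left_mono riesz_energy_image_le[OF \<mu>])
      fix i assume "i \<in> I"
      then have "matrix_image (U i) K = K" using U by (auto simp: isometry_group_def isometry_of_def)
      then show "(\<lambda>x. M *v (U i *v x)) ` K \<subseteq> matrix_image M K"
        by (auto simp: matrix_image_def)
      show "(\<lambda>x. M *v (U i *v x)) \<in> borel_measurable borel"
        by (intro borel_measurable_continuous_onI continuous_intros)
    qed auto
    also have "\<dots> = (\<integral>\<^sup>+ y. (\<integral>\<^sup>+ x. (\<Sum>i\<in>I. ennreal (w i) * ?k i x y) \<partial>\<mu>) \<partial>\<mu>)"
    proof -
      have "(\<integral>\<^sup>+ x. (\<Sum>i\<in>I. ennreal (w i) * ?k i x y) \<partial>\<mu>) = (\<Sum>i\<in>I. ennreal (w i) * (\<integral>\<^sup>+ x. ?k i x y \<partial>\<mu>))" for y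
        by (simp add: nn_integral_sum nn_integral_cmult)
      moreover have "(\<lambda>y. \<integral>\<^sup>+ x. ?k i x y \<partial>\<mu>) \<in> borel_measurable \<mu>" for i
        by measurable
      ultimately show ?thesis by (simp add: nn_integral_sum nn_integral_cmult)
    qed
    also have "\<dots> \<le> (\<integral>\<^sup>+ y. (\<integral>\<^sup>+ x. ennreal C * riesz_kernel p x y \<partial>\<mu>) \<partial>\<mu>)"
    proof (intro nn_integral_mono)
      fix x y
      show "(\<Sum>i\<in>I. ennreal (w i) * ?k i x y) \<le> ennreal C * riesz_kernel p x y"
      \<comment> \<open>On the diagonal the right side is infinite because \<open>C\<close> is
        positive; \<open>le\<close> is used only for the nonzero vector
        \<open>x - y\<close>.\<close>
      proof (cases "x = y")
        case True
        then show ?thesis using C by (simp add: ennreal_mult_top)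
      next
        case False
        have "?k i x y = ennreal (norm (M *v (U i *v (x - y))) powr - p)" if "i \<in> I" for i
        proof -
          have "transpose (U i) ** U i = mat 1" using U[OF that] by (simp add: isometry_group_alt)
          then have "(transpose (U i) ** matrix_inv M) *v (M *v (U i *v z)) = z" for z
            using invertible_matrix_inv(2)[OF M]
            by (simp add: matrix_vector_mul_assoc) (metis matrix_mul_assoc matrix_mul_lid matrix_vector_mul_lid)
          then have "M *v (U i *v x) \<noteq> M *v (U i *v y)" using False by metis
          then show ?thesis by (simp add: riesz_kernel_eq matrix_vector_mult_diff_distrib)
        qed
        then have "(\<Sum>i\<in>I. ennreal (w i) * ?k i x y)
            = (\<Sum>i\<in>I. ennreal (w i * norm (M *v (U i *v (x - y))) powr - p))"
          using I by (intro sum.cong) (auto simp: ennreal_mult less_imp_le)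
        also have "\<dots> = ennreal (\<Sum>i\<in>I. w i * norm (M *v (U i *v (x - y))) powr - p)"
          using I by (intro sum_ennreal) (auto simp: less_imp_le)
        also have "\<dots> \<le> ennreal (C * norm (x - y) powr - p)"
          using False by (intro ennreal_leI le) simp
        finally show ?thesis using False C by (simp add: riesz_kernel_eq ennreal_mult)
      qed
    qed
    also have "\<dots> = ennreal C * (\<integral>\<^sup>+ y. (\<integral>\<^sup>+ x. riesz_kernel p x y \<partial>\<mu>) \<partial>\<mu>)"
    proof -
      have [measurable]: "(\<lambda>y. \<integral>\<^sup>+ x. riesz_kernel p x y \<partial>\<mu>) \<in> borel_measurable \<mu>"
        by measurable
      show ?thesis by (simp add: nn_integral_cmult)
    qed
    finally have "ennreal (1 / C) * ?E \<le> ennreal (1 / C) * (ennreal C * (\<integral>\<^sup>+ y. (\<integral>\<^sup>+ x. riesz_kernel p x y \<partial>\<mu>) \<partial>\<mu>))"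
      by (rule mult_left_mono) simp
    then show ?thesis by (simp add: cancel)
  qed
  then have "ennreal (1 / C) * ?E \<le> riesz_energy p K"
    unfolding riesz_energy_def[of p K] by (rule INF_greatest)
  then have "ennreal C * (ennreal (1 / C) * ?E) \<le> ennreal C * riesz_energy p K"
    by (rule mult_left_mono) simp
  then show ?thesis by (simp add: cancel)
qed

section \<open>Positivity and finiteness of the energy\<close>

text \<open>Distances in \<open>K\<close> are at most \<open>2 * D\<close>, so the kernel, and with
  it the energy of every probability measure, is at least \<open>(2 * D) powr - p\<close>. Energy 0
  must be excluded because \<open>0 powr (- 1 / p)\<close> is 0, which would make the capacity
  vanish.\<close>

lemma riesz_energy_pos:
  fixes K :: "'a::euclidean_space set"
  assumes K: "compact K" and p: "0 < p"
  shows "0 < riesz_energy p K"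
proof -
  obtain D where D: "0 < D" "\<And>x. x \<in> K \<Longrightarrow> norm x \<le> D"
    using compact_imp_bounded[OF K] by (auto simp: bounded_pos)
  define c where "c = (2 * D) powr - p"
  have "ennreal c \<le> (\<integral>\<^sup>+ y. (\<integral>\<^sup>+ x. riesz_kernel p x y \<partial>\<mu>) \<partial>\<mu>)"
    if \<mu>: "\<mu> \<in> borel_prob_measures_on K" for \<mu>
  proof -
    interpret prob_space \<mu> using borel_prob_measures_onD[OF \<mu>] by simp
    have "ennreal c = (\<integral>\<^sup>+ y. (\<integral>\<^sup>+ x. ennreal c \<partial>\<mu>) \<partial>\<mu>)"
      by (simp add: emeasure_space_1)
    also have "\<dots> \<le> (\<integral>\<^sup>+ y. (\<integral>\<^sup>+ x. riesz_kernel p x y \<partial>\<mu>) \<partial>\<mu>)"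
    proof (intro nn_integral_mono)
      fix x y assume "x \<in> space \<mu>" "y \<in> space \<mu>"
      then have "norm (x - y) \<le> 2 * D"
        using D(2)[of x] D(2)[of y] borel_prob_measures_onD(2)[OF \<mu>] norm_triangle_ineq4[of x y] by simp
      then show "ennreal c \<le> riesz_kernel p x y"
        using p by (cases "x = y") (auto simp: riesz_kernel_eq c_def intro!: ennreal_leI powr_mono2')
    qed
    finally show ?thesis .
  qed
  then have "ennreal c \<le> riesz_energy p K"
    unfolding riesz_energy_def by (rule INF_greatest)
  moreover have "0 < c" using D by (simp add: c_def)
  ultimately show ?thesis by (metis ennreal_less_zero_iff order_less_le_trans)
qed

lemma dyadic_shell:
  fixes t :: real
  assumes "1 \<le> t"
  obtains k where "2 ^ k \<le> t" "t < 2 ^ Suc k"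
proof -
  obtain N where "t < 2 ^ N" using real_arch_pow[of 2 t] by auto
  then obtain k where "\<forall>i\<le>k. \<not> t < 2 ^ i" "t < 2 ^ (k + 1)"
    using ex_least_nat_less[of "\<lambda>n. t < 2 ^ n" N] assms by auto
  then show thesis using that[of k] by (simp add: linorder_not_less)
qed

text \<open>Off the origin the ball is covered by the shells
  \<open>R / 2 ^ Suc k \<le> norm x \<le> R / 2 ^ k\<close>. On each the kernel is at most
  \<open>h k\<close>, its value at the inner radius, and the shell is enlarged to a full ball. The
  resulting series is geometric with ratio \<open>r < 1\<close>, because \<open>p\<close> is below
  the dimension.\<close>

lemma nn_integral_riesz_kernel_cball:
  fixes p :: real
  assumes R: "0 < R" and p: "0 < p" "p < DIM('a::euclidean_space)"
  shows "(\<integral>\<^sup>+ x. riesz_kernel p x 0 * indicator (cball (0::'a) R) x \<partial>lborel) < \<infinity>"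
proof -
  let ?n = "DIM('a)" and ?v = "unit_ball_vol (real DIM('a))"
  define r where "r = 2 powr (p - ?n)"
  \<comment> \<open>The k-th term of the series will be \<open>c * r ^ k\<close>; the factor
    \<open>2 powr p\<close> arises because the inner radius is half the outer one.\<close>
  define c where "c = R powr - p * 2 powr p * ?v * R ^ ?n"
  have r: "0 < r" "r < 1"
    using powr_less_one[of 2 "p - ?n"] p unfolding r_def by simp_all
  have c: "0 \<le> c" using R by (simp add: c_def)
  define h where "h k = (R / 2 ^ Suc k) powr - p" for k :: nat
  have shell: "riesz_kernel p x 0 * indicator (cball 0 R) x \<le> (\<Sum>k. ennreal (h k) * indicator (cball 0 (R / 2 ^ k)) x)"
    if "x \<noteq> 0" for x :: 'a
  proof (cases "x \<in> cball 0 R")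
    case True
    then have "1 \<le> R / norm x" using that by simp
    then obtain k where k: "2 ^ k \<le> R / norm x" "R / norm x < 2 ^ Suc k" by (rule dyadic_shell)
    have x: "norm x \<le> R / 2 ^ k" "R / 2 ^ Suc k \<le> norm x"
      using k that by (simp_all add: field_simps)
    have "norm x powr - p \<le> h k"
      unfolding h_def using x R p by (intro powr_mono2') auto
    then have "riesz_kernel p x 0 \<le> ennreal (h k)"
      using that by (simp add: riesz_kernel_eq ennreal_leI)
    also have "\<dots> = (\<Sum>j\<in>{k}. ennreal (h j) * indicator (cball 0 (R / 2 ^ j)) x)"
      using x by simp
    also have "\<dots> \<le> (\<Sum>j. ennreal (h j) * indicator (cball 0 (R / 2 ^ j)) x)"
      by (rule sum_le_suminf) auto
    finally show ?thesis using True by simp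
  qed simp
  have [measurable, simp]: "cball (0::'a) s \<in> sets borel" for s by (rule borel_closed) simp
  have hk: "h k * (?v * (R / 2 ^ k) ^ ?n) = c * r ^ k" for k
  proof -
    have "h k = R powr - p * (2 ^ Suc k) powr p"
      using R by (simp add: h_def powr_divide powr_minus_divide)
    also have "((2::real) ^ Suc k) powr p = 2 powr p * (2 powr p) ^ k"
      by (simp add: powr_mult powr_powr powr_realpow[symmetric] mult.commute del: powr_realpow)
    finally have "h k = R powr - p * 2 powr p * (2 powr p) ^ k" by simp
    moreover have "(R / 2 ^ k) ^ ?n = R ^ ?n * (1 / 2 ^ ?n) ^ k"
      by (simp add: power_divide power_mult[symmetric] mult.commute)
    moreover have "r = 2 powr p * (1 / 2 ^ ?n)"
      by (simp add: r_def powr_diff powr_realpow)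
    ultimately show ?thesis by (simp only: c_def power_mult_distrib mult_ac)
  qed
  have "(\<integral>\<^sup>+ x. riesz_kernel p x 0 * indicator (cball (0::'a) R) x \<partial>lborel)
      \<le> (\<integral>\<^sup>+ x. (\<Sum>k. ennreal (h k) * indicator (cball 0 (R / 2 ^ k)) x) \<partial>(lborel :: 'a measure))"
  proof (rule nn_integral_mono_AE)
    have "AE x in lborel. x \<noteq> (0::'a)" by (rule AE_lborel_singleton)
    then show "AE x in lborel. riesz_kernel p x 0 * indicator (cball (0::'a) R) x
        \<le> (\<Sum>k. ennreal (h k) * indicator (cball 0 (R / 2 ^ k)) x)"
      by eventually_elim (rule shell)
  qed
  also have "\<dots> = (\<Sum>k. \<integral>\<^sup>+ x. ennreal (h k) * indicator (cball 0 (R / 2 ^ k)) x \<partial>(lborel :: 'a measure))"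
    by (rule nn_integral_suminf) measurable
  also have "\<dots> = (\<Sum>k. ennreal (c * r ^ k))"
  proof (rule suminf_cong)
    fix k
    have "(\<integral>\<^sup>+ x. ennreal (h k) * indicator (cball 0 (R / 2 ^ k)) x \<partial>(lborel :: 'a measure))
        = ennreal (h k) * ennreal (?v * (R / 2 ^ k) ^ ?n)"
      using R by (simp add: nn_integral_cmult_indicator emeasure_cball)
    also have "\<dots> = ennreal (h k * (?v * (R / 2 ^ k) ^ ?n))"
      using R by (simp add: ennreal_mult h_def)
    finally show "(\<integral>\<^sup>+ x. ennreal (h k) * indicator (cball 0 (R / 2 ^ k)) x \<partial>(lborel :: 'a measure)) = ennreal (c * r ^ k)"
      unfolding hk .
  qed
  also have "\<dots> = ennreal (\<Sum>k. c * r ^ k)"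
    using r c by (intro suminf_ennreal2 summable_mult summable_geometric) auto
  also have "\<dots> < \<infinity>" by simp
  finally show ?thesis .
qed

text \<open>The test measure is normalised volume on \<open>K\<close>. Its potential at a point
  \<open>y\<close> of \<open>K\<close> is at most the kernel integral over the ball of radius
  \<open>2 * D\<close> about \<open>y\<close>, divided by the volume of \<open>K\<close>; by
  translation this bound does not depend on \<open>y\<close>. Finiteness keeps the capacity
  positive, so that strict bounds on its factor stay strict.\<close>

lemma riesz_energy_finite:
  fixes K :: "'a::euclidean_space set" and p :: real
  assumes K: "compact K" and vol: "0 < vol K" and p: "0 < p" "p < DIM('a)"
  shows "riesz_energy p K < \<infinity>"
proof -
  obtain D where D: "0 < D" "\<And>x. x \<in> K \<Longrightarrow> norm x \<le> D"
    using compact_imp_bounded[OF K] by (auto simp: bounded_pos)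
  have [measurable]: "K \<in> sets borel" using K by (rule borel_compact)
  have volK: "0 < emeasure lborel K" "emeasure lborel K < \<infinity>"
    using vol emeasure_compact_finite[OF K] by (auto simp: measure_def enn2real_positive_iff)
  define \<mu> where "\<mu> = restrict_space (uniform_measure lborel K) K"
  have \<mu>: "\<mu> \<in> borel_prob_measures_on K"
  proof -
    have "prob_space \<mu>"
      unfolding \<mu>_def using volK
      by (intro prob_spaceI) (simp add: emeasure_restrict_space space_restrict_space)
    then show ?thesis
      by (auto simp: borel_prob_measures_on_def \<mu>_def sets_restrict_space)
  qed
  interpret prob_space \<mu> using borel_prob_measures_onD[OF \<mu>] by simp
  define B where "B = (\<integral>\<^sup>+ x. riesz_kernel p x 0 * indicator (cball (0::'a) (2 * D)) x \<partial>lborel)"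
  have B: "B < \<infinity>" unfolding B_def using D p by (intro nn_integral_riesz_kernel_cball) auto
  have inner: "(\<integral>\<^sup>+ x. riesz_kernel p x y \<partial>\<mu>) \<le> B / emeasure lborel K" if y: "y \<in> K" for y
  proof -
    have "(\<integral>\<^sup>+ x. riesz_kernel p x y \<partial>\<mu>) = (\<integral>\<^sup>+ x. riesz_kernel p x y * indicator K x \<partial>uniform_measure lborel K)"
      unfolding \<mu>_def by (subst nn_integral_restrict_space) auto
    also have "\<dots> = (\<integral>\<^sup>+ x. riesz_kernel p x y * indicator K x * indicator K x \<partial>lborel) / emeasure lborel K"
      using volK by (subst nn_integral_uniform_measure) auto
    also have "(\<integral>\<^sup>+ x. riesz_kernel p x y * indicator K x * indicator K x \<partial>lborel)
        \<le> (\<integral>\<^sup>+ x. riesz_kernel p x y * indicator (cball y (2 * D)) x \<partial>lborel)"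
    proof (intro nn_integral_mono)
      fix x
      have "dist y x \<le> 2 * D" if "x \<in> K"
        using D(2)[OF y] D(2)[OF that] norm_triangle_ineq4[of y x] by (simp add: dist_norm)
      then show "riesz_kernel p x y * indicator K x * indicator K x \<le> riesz_kernel p x y * indicator (cball y (2 * D)) x"
        by (auto simp: indicator_def)
    qed
    also have "(\<integral>\<^sup>+ x. riesz_kernel p x y * indicator (cball y (2 * D)) x \<partial>lborel) = B"
      unfolding B_def
      by (subst lborel_affine[of 1 y])
         (simp_all add: nn_integral_density nn_integral_distr density_1 riesz_kernel_def indicator_def dist_norm)
    finally show ?thesis by (simp add: divide_right_mono_ennreal)
  qed
  have "riesz_energy p K \<le> (\<integral>\<^sup>+ y. (\<integral>\<^sup>+ x. riesz_kernel p x y \<partial>\<mu>) \<partial>\<mu>)"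
    unfolding riesz_energy_def by (rule INF_lower[OF \<mu>])
  also have "\<dots> \<le> (\<integral>\<^sup>+ y. B / emeasure lborel K \<partial>\<mu>)"
    using inner borel_prob_measures_onD(2)[OF \<mu>] by (intro nn_integral_mono) auto
  also have "\<dots> = B / emeasure lborel K" by (simp add: emeasure_space_1)
  also have "B / emeasure lborel K < \<infinity>"
    using B volK by (auto simp: ennreal_divide_eq_top_iff less_top[symmetric])
  finally show ?thesis .
qed

section \<open>Moments and pointwise averages\<close>

lemma integrable_lebesgue_compact:
  fixes f :: "'a::euclidean_space \<Rightarrow> 'b::euclidean_space"
  assumes K: "compact K" and f: "continuous_on UNIV f"
  shows "set_integrable lebesgue K f"
proof -
  have [measurable]: "K \<in> sets borel" "f \<in> borel_measurable borel"
    using K f by (auto intro: borel_compact borel_measurable_continuous_onI)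
  have "integrable lborel (\<lambda>x. indicator K x *\<^sub>R f x)"
    using K f by (intro borel_integrable_compact) (auto intro: continuous_on_subset)
  then show ?thesis
    unfolding set_integrable_def by (subst integrable_completion) auto
qed

lemma vol_matrix_image:
  fixes M :: "real^'n^'n"
  assumes M: "invertible M" and K: "compact K"
  shows "vol (matrix_image M K) = \<bar>det M\<bar> * vol K"
proof -
  have "(LINT x:L|lebesgue. (1::real)) = vol L" for L :: "(real^'n) set"
    by (simp add: set_lebesgue_integral_def)
  then show ?thesis
    using set_lebesgue_integral_matrix_image[OF M K, of "\<lambda>_. 1 :: real"] by simp
qed

lemma isometry_groupD:
  fixes U :: "real^'n^'n"
  assumes "U \<in> isometry_group K"
  shows "orthogonal_matrix U" "matrix_image U K = K" "invertible U" "\<bar>det U\<bar> = 1"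
proof -
  show U: "orthogonal_matrix U" "matrix_image U K = K"
    using assms by (auto simp: isometry_group_def isometry_of_def)
  show "invertible U" using U by (auto simp: invertible_def orthogonal_matrix_def)
  show "\<bar>det U\<bar> = 1" by (rule abs_det_orthogonal[OF U(1)])
qed

lemma set_lebesgue_integral_isometry:
  fixes f :: "real^'n \<Rightarrow> 'b::euclidean_space"
  assumes "U \<in> isometry_group K" "compact K" "continuous_on UNIV f"
  shows "(LINT x:K|lebesgue. f (U *v x)) = (LINT x:K|lebesgue. f x)"
  using set_lebesgue_integral_matrix_image[OF isometry_groupD(3)[OF assms(1)] assms(2,3)]
    isometry_groupD(2,4)[OF assms(1)] by simp

lemma set_lebesgue_integral_matrix_vector:
  fixes M :: "real^'n^'n"
  assumes "compact K"
  shows "(LINT x:K|lebesgue. M *v x) = M *v (LINT x:K|lebesgue. x)"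
proof -
  have "bounded_linear ((*v) M)" by (simp add: linear_conv_bounded_linear[symmetric])
  then show ?thesis
    using integral_bounded_linear[of "(*v) M" lebesgue "\<lambda>x. indicator K x *\<^sub>R x"]
      integrable_lebesgue_compact[OF assms continuous_on_id]
    by (simp add: set_lebesgue_integral_def set_integrable_def matrix_vector_mult_scaleR)
qed

text \<open>The vector is fixed by every isometry, so its span is an invariant subspace of dimension
  at most 1, which in dimension at least 2 is not the whole space.\<close>

lemma integral_position_eq_0:
  fixes K :: "(real^'n) set"
  assumes n: "2 \<le> CARD('n)" and K: "compact K" and irr: "irreducible_group (isometry_group K)"
  shows "(LINT x:K|lebesgue. x) = 0"
proof -
  define c where "c = (LINT x:K|lebesgue. x)"
  have fixed: "U *v c = c" if "U \<in> isometry_group K" for U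
    using set_lebesgue_integral_isometry[OF that K continuous_on_id]
      set_lebesgue_integral_matrix_vector[OF K, of U] by (simp add: c_def)
  have "matrix_image U (span {c}) \<subseteq> span {c}" if "U \<in> isometry_group K" for U
    using fixed[OF that] by (auto simp: matrix_image_def span_singleton matrix_vector_mult_scaleR)
  then have "span {c} = {0} \<or> span {c} = UNIV"
    using irr unfolding irreducible_group_def by (meson subspace_span)
  moreover have "span {c} \<noteq> UNIV"
  proof
    assume "span {c} = UNIV"
    then have "dim (UNIV :: (real^'n) set) \<le> card {c}" by (intro dim_le_card) auto
    then show False using n by simp
  qed
  ultimately have "span {c} = {0}" by blast
  then have "c = 0" using span_base[of c "{c}"] by blast
  then show ?thesis by (simp add: c_def)
qed

text \<open>Irreducibility puts both centroids at the origin. Replacing \<open>x\<close> by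
  \<open>U i *v x\<close> leaves the integral of \<open>(norm (M *v x))^2\<close> over
  \<open>K\<close> unchanged, and the weighted average of these integrands is a multiple of
  \<open>(norm x)^2\<close>.\<close>

lemma second_moment_matrix_image:
  fixes M :: "real^'n^'n"
  assumes n: "2 \<le> CARD('n)" and K: "compact K" and irr: "irreducible_group (isometry_group K)"
    and M: "invertible M"
  shows "second_moment (matrix_image M K) = \<bar>det M\<bar> * ((norm M)\<^sup>2 / CARD('n)) * second_moment K"
proof -
  note zero = integral_position_eq_0[OF n K irr]
  have "centroid K = 0" by (simp add: centroid_def zero)
  then have I: "second_moment K = (LINT x:K|lebesgue. (norm x)\<^sup>2)" by (simp add: second_moment_def)
  have "centroid (matrix_image M K) = 0"
    using set_lebesgue_integral_matrix_image[OF M K continuous_on_id]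
      set_lebesgue_integral_matrix_vector[OF K, of M]
    by (simp add: centroid_def zero)
  then have "second_moment (matrix_image M K) = (LINT x:matrix_image M K|lebesgue. (norm x)\<^sup>2)"
    by (simp add: second_moment_def)
  also have "\<dots> = \<bar>det M\<bar> * (LINT x:K|lebesgue. (norm (M *v x))\<^sup>2)"
    by (subst set_lebesgue_integral_matrix_image[OF M K], intro continuous_intros) simp
  also have "(LINT x:K|lebesgue. (norm (M *v x))\<^sup>2) = (norm M)\<^sup>2 / CARD('n) * second_moment K"
  proof -
    obtain J :: "(real^'n^'n) set" and w U where J: "finite J" "\<And>i. i \<in> J \<Longrightarrow> 0 < w i" "sum w J = 1"
        "\<And>i. i \<in> J \<Longrightarrow> U i \<in> isometry_group K"
      and avg: "\<And>x. (\<Sum>i\<in>J. w i * (norm (M *v (U i *v x)))\<^sup>2) = (norm M)\<^sup>2 / CARD('n) * (norm x)\<^sup>2"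
      by (rule irreducible_group_average[OF isometry_group_group irr compact_isometry_group[OF K], of M])
        (rule that)
    have int: "set_integrable lebesgue K (\<lambda>x. w i * (norm (M *v (U i *v x)))\<^sup>2)" for i
      by (rule integrable_lebesgue_compact[OF K]) (intro continuous_intros)
    have "(LINT x:K|lebesgue. (norm (M *v x))\<^sup>2) = (\<Sum>i\<in>J. w i * (LINT x:K|lebesgue. (norm (M *v x))\<^sup>2))"
      using J(3) by (simp flip: sum_distrib_right)
    also have "\<dots> = (\<Sum>i\<in>J. LINT x:K|lebesgue. w i * (norm (M *v (U i *v x)))\<^sup>2)"
    proof (rule sum.cong)
      fix i assume "i \<in> J"
      then have "(LINT x:K|lebesgue. (norm (M *v (U i *v x)))\<^sup>2) = (LINT x:K|lebesgue. (norm (M *v x))\<^sup>2)"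
        by (intro set_lebesgue_integral_isometry[OF J(4) K, of _ "\<lambda>x. (norm (M *v x))\<^sup>2"] continuous_intros)
      then show "w i * (LINT x:K|lebesgue. (norm (M *v x))\<^sup>2) = (LINT x:K|lebesgue. w i * (norm (M *v (U i *v x)))\<^sup>2)"
        by simp
    qed simp
    also have "\<dots> = (LINT x:K|lebesgue. (\<Sum>i\<in>J. w i * (norm (M *v (U i *v x)))\<^sup>2))"
      using int unfolding set_lebesgue_integral_def set_integrable_def
      by (simp add: scaleR_sum_right Bochner_Integration.integral_sum del: real_scaleR_def)
    also have "\<dots> = (norm M)\<^sup>2 / CARD('n) * second_moment K"
      unfolding avg I by simp
    finally show ?thesis .
  qed
  finally show ?thesis by (simp add: mult.assoc)
qed

text \<open>The integrand vanishes on \<open>K\<close> at most at the centroid, a null set, so a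
  zero integral would make \<open>K\<close> null.\<close>

lemma second_moment_pos:
  fixes K :: "'a::euclidean_space set"
  assumes K: "compact K" and vol: "0 < vol K"
  shows "0 < second_moment K"
proof -
  let ?f = "\<lambda>x. indicator K x *\<^sub>R (norm (x - centroid K))\<^sup>2"
  have int: "integrable lebesgue ?f"
  proof -
    have "continuous_on UNIV (\<lambda>x. (norm (x - centroid K))\<^sup>2)" by (intro continuous_intros)
    then show ?thesis
      using integrable_lebesgue_compact[OF K] unfolding set_integrable_def by blast
  qed
  have "0 \<le> second_moment K"
    unfolding second_moment_def set_lebesgue_integral_def by (rule integral_nonneg_AE) simp
  moreover have "second_moment K \<noteq> 0"
  proof
    assume "second_moment K = 0"
    then have "AE x in lebesgue. ?f x = 0"
      using integral_nonneg_eq_0_iff_AE[OF int] by (simp add: second_moment_def set_lebesgue_integral_def)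
    moreover have "AE x in lebesgue. x \<noteq> centroid K"
      by (intro AE_completion AE_lborel_singleton)
    ultimately have "AE x in lebesgue. x \<notin> K"
      by eventually_elim (auto simp: indicator_def split: if_splits)
    moreover have "K \<in> sets lebesgue" using borel_compact[OF K] by simp
    ultimately have "K \<in> null_sets lebesgue" by (simp add: AE_iff_null_sets)
    then show False using vol by (simp add: measure_def null_setsD1)
  qed
  ultimately show ?thesis by simp
qed

section \<open>Norm and determinant inequalities for a matrix and its inverse\<close>

lemma norm_transpose_matrix: "norm (transpose A) = norm (A :: real^'n^'n)"
proof -
  have "(norm (transpose A))\<^sup>2 = (norm A)\<^sup>2"
    using trace_mul_sym[of A "transpose A"] by (simp add: norm_matrix_sq)
  then show ?thesis by simp
qed

lemma svd_norms:
  fixes Q R :: "real^'n^'n"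
  assumes QR: "orthogonal_matrix Q" "orthogonal_matrix R" and a: "\<And>i. 0 < a i"
    and M: "M = Q ** diag_matrix a ** R"
  shows "(norm M)\<^sup>2 = (\<Sum>i\<in>UNIV. (a i)\<^sup>2)" "(norm (matrix_inv M))\<^sup>2 = (\<Sum>i\<in>UNIV. 1 / (a i)\<^sup>2)"
    "\<bar>det M\<bar> = (\<Prod>i\<in>UNIV. a i)"
proof -
  show "(norm M)\<^sup>2 = (\<Sum>i\<in>UNIV. (a i)\<^sup>2)"
    unfolding M by (simp add: norm_orthogonal_mult QR norm_diag_matrix_sq)
  show det: "\<bar>det M\<bar> = (\<Prod>i\<in>UNIV. a i)"
    using abs_det_orthogonal[OF QR(1)] abs_det_orthogonal[OF QR(2)] a
    by (simp add: M det_mul det_diag_matrix abs_mult abs_of_pos prod_pos)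
  let ?N = "transpose R ** diag_matrix (\<lambda>i. 1 / a i) ** transpose Q"
  have a0: "a i \<noteq> 0" for i using a[of i] by simp
  have "M ** ?N = Q ** diag_matrix a ** (R ** transpose R) ** diag_matrix (\<lambda>i. 1 / a i) ** transpose Q"
    unfolding M by (simp add: matrix_mul_assoc)
  also have "\<dots> = Q ** (diag_matrix a ** diag_matrix (\<lambda>i. 1 / a i)) ** transpose Q"
    using QR by (simp add: orthogonal_matrix_def matrix_mul_assoc)
  also have "\<dots> = mat 1"
    using QR a0 diag_matrix_const[of 1, where ?'a='n] by (simp add: diag_matrix_mult orthogonal_matrix_def)
  finally have MN: "M ** ?N = mat 1" .
  then have "invertible M" unfolding invertible_right_inverse by blast
  then have "matrix_inv M = (matrix_inv M ** M) ** ?N"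
    using MN by (simp flip: matrix_mul_assoc)
  then have "matrix_inv M = ?N" by (simp add: invertible_matrix_inv[OF \<open>invertible M\<close>])
  then show "(norm (matrix_inv M))\<^sup>2 = (\<Sum>i\<in>UNIV. 1 / (a i)\<^sup>2)"
    by (simp add: norm_orthogonal_mult QR norm_diag_matrix_sq power_divide)
qed

lemma svd_const_similarity:
  fixes Q R :: "real^'n^'n"
  assumes "orthogonal_matrix Q" "orthogonal_matrix R" "M = Q ** diag_matrix (\<lambda>_. c) ** R" "0 < c"
  shows "euclidean_similarity M"
  unfolding euclidean_similarity_def
  using assms by (intro exI[of _ c] exI[of _ "Q ** R"])
    (auto simp: diag_matrix_const scaleR_matrix_mult intro: orthogonal_matrix_mul)

text \<open>In the squared singular values \<open>b i\<close>, the product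
  \<open>(det M)^2 * (norm (matrix_inv M))^2\<close> is the elementary symmetric function of degree
  n - 1 and \<open>(norm M)^2\<close> that of degree 1. If \<open>M\<close> is not a similarity,
  some \<open>b j\<close> differs from the mean \<open>t'\<close>.\<close>

lemma det_norm_ineq:
  fixes M :: "real^'n^'n"
  assumes M: "invertible M"
  defines "t \<equiv> (norm (matrix_inv M))\<^sup>2 / CARD('n)" and "t' \<equiv> (norm M)\<^sup>2 / CARD('n)"
  shows "0 < t" "0 < t'" "(det M)\<^sup>2 * t \<le> t' ^ (CARD('n) - 1)"
    "3 \<le> CARD('n) \<Longrightarrow> \<not> euclidean_similarity M \<Longrightarrow> (det M)\<^sup>2 * t < t' ^ (CARD('n) - 1)"
proof -
  obtain Q R a where QR: "orthogonal_matrix Q" "orthogonal_matrix R" and a: "\<And>i. 0 < a i"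
    and eq: "M = Q ** diag_matrix a ** R"
    using singular_value_decomposition[OF M] by blast
  note svd = svd_norms[OF QR a eq]
  define b where "b i = (a i)\<^sup>2" for i
  have b: "0 < b i" for i using a[of i] by (simp add: b_def)
  have t: "t = (\<Sum>i\<in>UNIV. 1 / b i) / CARD('n)" "t' = sum b UNIV / CARD('n)"
    by (simp_all add: t_def t'_def svd b_def)
  show "0 < t" "0 < t'" unfolding t using b by (auto intro!: divide_pos_pos sum_pos)
  have det: "(det M)\<^sup>2 = prod b UNIV"
    using svd(3) by (metis b_def power2_abs prod_power_distrib prod.cong)
  have lhs: "CARD('n) * ((det M)\<^sup>2 * t) = prod b UNIV * (\<Sum>i\<in>UNIV. 1 / b i)"
    by (simp add: det t)
  have "CARD('n) * ((det M)\<^sup>2 * t) \<le> CARD('n) * t' ^ (CARD('n) - 1)"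
    unfolding lhs t(2) by (rule maclaurin_ineq) (use b in auto)
  then show "(det M)\<^sup>2 * t \<le> t' ^ (CARD('n) - 1)" by simp
  show "(det M)\<^sup>2 * t < t' ^ (CARD('n) - 1)" if n: "3 \<le> CARD('n)" and ns: "\<not> euclidean_similarity M"
  proof -
    have "\<exists>j. b j \<noteq> t'"
    proof (rule ccontr)
      assume "\<nexists>j. b j \<noteq> t'"
      then have "a j = sqrt t'" for j using a[of j] by (metis b_def less_imp_le real_sqrt_unique)
      then have "a = (\<lambda>_. sqrt t')" by blast
      then show False using svd_const_similarity[OF QR, of M "sqrt t'"] eq a ns by metis
    qed
    then obtain j where "b j \<noteq> sum b UNIV / CARD('n)" by (auto simp: t)
    then have "CARD('n) * ((det M)\<^sup>2 * t) < CARD('n) * t' ^ (CARD('n) - 1)"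
      unfolding lhs t(2) using n b by (intro maclaurin_ineq_strict) auto
    then show ?thesis by simp
  qed
qed

text \<open>Half of \<open>(norm (matrix_inv M))^2\<close> is the mean of the two numbers
  \<open>1 / (a k)^2\<close>. The hypothesis makes its reciprocal an eigenvalue of
  \<open>transpose M ** M\<close>, so the mean is itself one of the two numbers, and then they
  coincide.\<close>

lemma two_dim_eigenvector_similarity:
  fixes M :: "real^'n^'n"
  assumes n: "CARD('n) = 2" and M: "invertible M" and y: "y \<noteq> 0"
    and eig: "y = ((norm (matrix_inv M))\<^sup>2 / 2) *\<^sub>R ((transpose M ** M) *v y)"
  shows "euclidean_similarity M"
proof -
  obtain Q R a where QR: "orthogonal_matrix Q" "orthogonal_matrix R" and a: "\<And>i. 0 < a i"
    and eq: "M = Q ** diag_matrix a ** R"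
    using singular_value_decomposition[OF M] by blast
  let ?t = "(norm (matrix_inv M))\<^sup>2 / 2"
  have "R ** (transpose M ** M) = (R ** transpose R) ** diag_matrix a ** (transpose Q ** Q) ** diag_matrix a ** R"
    unfolding eq by (simp add: matrix_transpose_mul matrix_mul_assoc)
  also have "\<dots> = diag_matrix (\<lambda>i. a i * a i) ** R"
    using QR by (simp add: orthogonal_matrix_def diag_matrix_mult)
  finally have RP: "R ** (transpose M ** M) = diag_matrix (\<lambda>i. a i * a i) ** R" .
  have "R *v y = ?t *\<^sub>R ((R ** (transpose M ** M)) *v y)"
    using arg_cong[OF eig, of "(*v) R"] by (simp add: matrix_vector_mult_scaleR matrix_vector_mul_assoc)
  then have Ry: "R *v y = ?t *\<^sub>R (diag_matrix (\<lambda>i. a i * a i) *v (R *v y))"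
    unfolding RP matrix_vector_mul_assoc[symmetric] .
  have "R *v y \<noteq> 0" using orthogonal_matrix_norm[OF QR(2), of y] y by auto
  then obtain i where i: "(R *v y) $ i \<noteq> 0" by (auto simp: vec_eq_iff)
  have "(R *v y) $ i = ?t * (a i * a i * (R *v y) $ i)"
    using arg_cong[OF Ry, of "\<lambda>v. v $ i"] by (simp only: vector_scaleR_component diag_matrix_vector real_scaleR_def)
  then have "?t * (a i)\<^sup>2 = 1" using i by (simp add: power2_eq_square)
  then have t: "?t = 1 / (a i)\<^sup>2" using a[of i] by (simp add: field_simps)
  have "card (UNIV - {i}) = 1" using n by simp
  then obtain j where j: "UNIV - {i} = {j}" by (rule card_1_singletonE)
  then have U: "UNIV = {i, j}" "i \<noteq> j" by auto
  have "(norm (matrix_inv M))\<^sup>2 = 1 / (a i)\<^sup>2 + 1 / (a j)\<^sup>2"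
    unfolding svd_norms(2)[OF QR a eq] U(1) using U(2) by simp
  then have "1 / (a i)\<^sup>2 = 1 / (a j)\<^sup>2" using t by linarith
  then have "(a i)\<^sup>2 = (a j)\<^sup>2" by simp
  then have "a j = a i" using a[of i] a[of j] by (simp add: power2_eq_iff_nonneg less_imp_le)
  have "a k = a i" for k
  proof -
    have "k \<in> {i, j}" using U(1) by blast
    then show ?thesis using \<open>a j = a i\<close> by auto
  qed
  then have "a = (\<lambda>_. a i)" by blast
  then show ?thesis using svd_const_similarity[OF QR, of M "a i"] eq a by metis
qed

text \<open>Cauchy-Schwarz gives \<open>c i \<le> b i\<close>, so the weighted mean of the
  \<open>c i\<close> is at most that of the \<open>b i\<close>, which is \<open>t\<close>. Jensen's
  inequality takes the form of the tangent to the concave power at \<open>t\<close>, not at the mean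
  of the \<open>c i\<close>: its slope is nonnegative, so both inequalities are absorbed at
  once.\<close>

lemma average_inverse_norm_le:
  fixes M :: "real^'n^'n" and w :: "'i \<Rightarrow> real"
  assumes M: "invertible M" and I: "finite I" "\<And>i. i \<in> I \<Longrightarrow> 0 < w i" "sum w I = 1"
    and U: "\<And>i. i \<in> I \<Longrightarrow> orthogonal_matrix (U i)"
    and avg: "\<And>x. (\<Sum>i\<in>I. w i * (norm (transpose (matrix_inv M) *v (U i *v x)))\<^sup>2)
        = (norm (matrix_inv M))\<^sup>2 / CARD('n) * (norm x)\<^sup>2"
    and p: "0 < p" "p \<le> 2" and x: "norm x = 1"
  defines "t \<equiv> (norm (matrix_inv M))\<^sup>2 / CARD('n)"
  shows "(\<Sum>i\<in>I. w i * norm (M *v (U i *v x)) powr - p) \<le> t powr (p / 2)"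
    and "CARD('n) = 2 \<Longrightarrow> p < 2 \<Longrightarrow> \<not> euclidean_similarity M \<Longrightarrow>
      (\<Sum>i\<in>I. w i * norm (M *v (U i *v x)) powr - p) < t powr (p / 2)"
proof -
  define A where "A = transpose (matrix_inv M)"
  define y where "y i = U i *v x" for i
  define c where "c i = 1 / (norm (M *v y i))\<^sup>2" for i
  define b where "b i = (norm (A *v y i))\<^sup>2" for i
  define q where "q = p / 2"
  have q: "0 < q" "q \<le> 1" using p by (auto simp: q_def)
  have t: "0 < t" unfolding t_def by (rule det_norm_ineq[OF M])
  have y: "norm (y i) = 1" if "i \<in> I" for i
    using orthogonal_matrix_norm[OF U[OF that]] x by (simp add: y_def)
  have My: "0 < norm (M *v y i)" if "i \<in> I" for i
  proof -
    have "(matrix_inv M ** M) *v y i = y i" using invertible_matrix_inv[OF M] by simp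
    then have "M *v y i \<noteq> 0" using y[OF that] by (auto simp: matrix_vector_mul_assoc[symmetric])
    then show ?thesis by simp
  qed
  have dual: "(M *v z) \<bullet> (A *v z) = (norm z)\<^sup>2" for z
  proof -
    have "(M *v z) \<bullet> (A *v z) = z \<bullet> ((transpose M ** A) *v z)"
      by (metis dot_lmul_matrix vector_transpose_matrix transpose_transpose matrix_vector_mul_assoc)
    also have "transpose M ** A = transpose (matrix_inv M ** M)"
      by (simp add: A_def matrix_transpose_mul)
    finally show ?thesis by (simp add: invertible_matrix_inv[OF M] power2_norm_eq_inner)
  qed
  have c: "0 < c i" if "i \<in> I" for i using My[OF that] by (simp add: c_def)
  have cb: "c i \<le> b i" if "i \<in> I" for i
  proof -
    have "1 \<le> norm (M *v y i) * norm (A *v y i)"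
      using dual[of "y i"] y[OF that] norm_cauchy_schwarz[of "M *v y i" "A *v y i"] by simp
    then have "1 \<le> (norm (M *v y i) * norm (A *v y i))\<^sup>2" by (rule one_le_power)
    then show ?thesis using My[OF that] by (simp add: c_def b_def power_mult_distrib field_simps)
  qed
  have sum_b: "(\<Sum>i\<in>I. w i * b i) = t"
    using avg[of x] x by (simp add: b_def y_def A_def t_def)
  have sum_c: "(\<Sum>i\<in>I. w i * c i) \<le> t"
    unfolding sum_b[symmetric] using I cb by (intro sum_mono mult_left_mono) (auto simp: less_imp_le)
  have powr_c: "norm (M *v (U i *v x)) powr - p = c i powr q" if "i \<in> I" for i
  proof -
    have "c i = norm (M *v y i) powr (- 2)"
      using My[OF that] by (simp add: c_def powr_minus_divide)
    then show ?thesis by (simp add: powr_powr q_def y_def)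
  qed
  have tangent: "(\<Sum>i\<in>I. w i * (t powr q + q * t powr (q - 1) * (c i - t))) \<le> t powr q"
  proof -
    have "(\<Sum>i\<in>I. w i * (t powr q + q * t powr (q - 1) * (c i - t)))
        = t powr q * sum w I + q * t powr (q - 1) * ((\<Sum>i\<in>I. w i * c i) - t * sum w I)"
      by (simp add: algebra_simps sum.distrib sum_subtractf sum_distrib_left) (simp add: sum_distrib_right)
    also have "\<dots> \<le> t powr q" using sum_c q I by (simp add: mult_nonneg_nonpos)
    finally show ?thesis .
  qed
  have term_le: "w i * c i powr q \<le> w i * (t powr q + q * t powr (q - 1) * (c i - t))" if "i \<in> I" for i
    using powr_le_tangent(1)[OF t c[OF that]] q I(2)[OF that] by (intro mult_left_mono) auto
  have eq: "(\<Sum>i\<in>I. w i * norm (M *v (U i *v x)) powr - p) = (\<Sum>i\<in>I. w i * c i powr q)"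
    by (intro sum.cong) (auto simp: powr_c)
  show "(\<Sum>i\<in>I. w i * norm (M *v (U i *v x)) powr - p) \<le> t powr (p / 2)"
    unfolding eq q_def[symmetric] by (rule order_trans[OF sum_mono[OF term_le] tangent])
  show "(\<Sum>i\<in>I. w i * norm (M *v (U i *v x)) powr - p) < t powr (p / 2)"
    if n: "CARD('n) = 2" and p2: "p < 2" and ns: "\<not> euclidean_similarity M"
  proof -
    \<comment> \<open>If every \<open>c i\<close> equals \<open>t\<close>, then
      \<open>b i = c i\<close> throughout and Cauchy-Schwarz is sharp at every \<open>y i\<close>; a
      single index then yields an eigenvector of \<open>transpose M ** M\<close>.\<close>
    have "\<exists>j\<in>I. c j \<noteq> t"
    proof (rule ccontr)
      assume "\<not> (\<exists>j\<in>I. c j \<noteq> t)"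
      then have ct: "c i = t" if "i \<in> I" for i using that by blast
      then have "(\<Sum>i\<in>I. w i * (b i - c i)) = 0"
        using sum_b I by (simp add: right_diff_distrib sum_subtractf flip: sum_distrib_right)
      moreover have "0 \<le> w i * (b i - c i)" if "i \<in> I" for i
        using cb[OF that] I(2)[OF that] by simp
      ultimately have wb: "w i * (b i - c i) = 0" if "i \<in> I" for i
        using sum_nonneg_eq_0_iff[OF I(1), of "\<lambda>i. w i * (b i - c i)"] that by blast
      obtain j where j: "j \<in> I" using I(3) by fastforce
      have bj: "b j = t" using wb[OF j] ct[OF j] I(2)[OF j] by simp
      let ?m = "norm (M *v y j)" and ?a = "norm (A *v y j)"
      have m: "0 < ?m" using My[OF j] .
      have t_m: "t = 1 / ?m\<^sup>2" using ct[OF j] by (simp add: c_def)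
      have "?a\<^sup>2 = (1 / ?m)\<^sup>2" using bj t_m by (simp add: b_def power_divide)
      then have a: "?a = 1 / ?m" using m by (simp add: power2_eq_iff_nonneg)
      \<comment> \<open>Equality in Cauchy-Schwarz makes the two vectors parallel; multiplying by
        \<open>transpose M\<close> turns \<open>A *v y j\<close> back into
        \<open>y j\<close>.\<close>
      have "(M *v y j) \<bullet> (A *v y j) = ?m * ?a" using dual[of "y j"] y[OF j] a m by simp
      then have "?m *\<^sub>R (A *v y j) = ?a *\<^sub>R (M *v y j)" by (simp add: norm_cauchy_schwarz_eq)
      then have "(1 / ?m) *\<^sub>R ?m *\<^sub>R (A *v y j) = (1 / ?m) *\<^sub>R ?a *\<^sub>R (M *v y j)" by simp
      then have "A *v y j = t *\<^sub>R (M *v y j)" using m by (simp add: a t_m power2_eq_square)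
      then have "transpose M *v (A *v y j) = t *\<^sub>R ((transpose M ** M) *v y j)"
        by (simp add: matrix_vector_mult_scaleR matrix_vector_mul_assoc)
      moreover have "transpose M *v (A *v y j) = y j"
      proof -
        have "transpose M ** A = transpose (matrix_inv M ** M)"
          by (simp add: A_def matrix_transpose_mul)
        then show ?thesis by (simp add: matrix_vector_mul_assoc invertible_matrix_inv[OF M])
      qed
      ultimately have "y j = ((norm (matrix_inv M))\<^sup>2 / 2) *\<^sub>R ((transpose M ** M) *v y j)"
        by (simp add: t_def n)
      moreover have "y j \<noteq> 0" using y[OF j] by auto
      ultimately show False using two_dim_eigenvector_similarity[OF n M] ns by blast
    qed
    then obtain j where j: "j \<in> I" "c j \<noteq> t" by blast
    have "q < 1" using p2 by (simp add: q_def)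
    have "w j * c j powr q < w j * (t powr q + q * t powr (q - 1) * (c j - t))"
      using powr_le_tangent(2)[OF t c[OF j(1)] less_imp_le[OF q(1)] q(2,1) \<open>q < 1\<close> j(2)] I(2)[OF j(1)]
      by (intro mult_strict_left_mono)
    then have "(\<Sum>i\<in>I. w i * c i powr q) < (\<Sum>i\<in>I. w i * (t powr q + q * t powr (q - 1) * (c i - t)))"
      using term_le j by (intro sum_strict_mono_ex1 I) auto
    then show ?thesis unfolding eq q_def[symmetric] using tangent by linarith
  qed
qed

section \<open>Capacity of linear images\<close>

text \<open>The strict bound in the plane is uniform in the direction by compactness of the unit circle;
  this makes the equality case independent of the existence of an equilibrium measure.\<close>

lemma riesz_energy_matrix_image_bound:
  fixes M :: "real^'n^'n"
  assumes K: "compact K" and irr: "irreducible_group (isometry_group K)" and M: "invertible M"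
    and p: "0 < p" "p \<le> 2"
  defines "t \<equiv> (norm (matrix_inv M))\<^sup>2 / CARD('n)"
  obtains C where "0 < C" "C \<le> t powr (p / 2)"
    "CARD('n) = 2 \<Longrightarrow> p < 2 \<Longrightarrow> \<not> euclidean_similarity M \<Longrightarrow> C < t powr (p / 2)"
    "riesz_energy p (matrix_image M K) \<le> ennreal C * riesz_energy p K"
proof -
  obtain I :: "(real^'n^'n) set" and w U where I: "finite I" "\<And>i. i \<in> I \<Longrightarrow> 0 < w i" "sum w I = 1"
      and U: "\<And>i. i \<in> I \<Longrightarrow> U i \<in> isometry_group K"
      and avg: "\<And>x. (\<Sum>i\<in>I. w i * (norm (transpose (matrix_inv M) *v (U i *v x)))\<^sup>2)
        = (norm (transpose (matrix_inv M)))\<^sup>2 / CARD('n) * (norm x)\<^sup>2"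
    by (rule irreducible_group_average[OF isometry_group_group irr compact_isometry_group[OF K],
          of "transpose (matrix_inv M)"]) (rule that)
  note bound = average_inverse_norm_le[OF M I isometry_groupD(1)[OF U] avg[unfolded norm_transpose_matrix] p, folded t_def]
  \<comment> \<open>\<open>g\<close> is homogeneous of degree \<open>- p\<close>, so its maximum on
    the unit sphere serves as the constant \<open>C\<close> for all directions.\<close>
  define g where "g x = (\<Sum>i\<in>I. w i * norm (M *v (U i *v x)) powr - p)" for x
  have ne: "norm (M *v (U i *v x)) \<noteq> 0" if "i \<in> I" "norm x = 1" for i x
  proof -
    have "norm (U i *v x) = 1" using orthogonal_matrix_norm[OF isometry_groupD(1)[OF U[OF that(1)]]] that by simp
    moreover have "matrix_inv M *v (M *v (U i *v x)) = U i *v x"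
      using invertible_matrix_inv[OF M] by (simp add: matrix_vector_mul_assoc matrix_mul_assoc)
    ultimately show ?thesis by auto
  qed
  have "continuous_on (sphere 0 1) g"
    unfolding g_def by (intro continuous_intros) (use ne in auto)
  moreover have "sphere (0 :: real^'n) 1 \<noteq> {}" by simp
  ultimately obtain z where z: "norm z = 1" and max: "\<And>x. norm x = 1 \<Longrightarrow> g x \<le> g z"
    using continuous_attains_sup[of "sphere (0 :: real^'n) 1" g] by auto
  have pos: "0 < g z"
    unfolding g_def
  proof (rule sum_pos)
    show "I \<noteq> {}" using I(3) by auto
    show "0 < w i * norm (M *v (U i *v z)) powr - p" if "i \<in> I" for i
      using ne[OF that z] I(2)[OF that] by simp
  qed fact
  show thesis
  proof (rule that[of "g z"])
    show "g z \<le> t powr (p / 2)" unfolding g_def using bound(1)[OF _ _ z] by simp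
    show "g z < t powr (p / 2)" if "CARD('n) = 2" "p < 2" "\<not> euclidean_similarity M"
      unfolding g_def using bound(2)[OF _ _ z that] by simp
    show "riesz_energy p (matrix_image M K) \<le> ennreal (g z) * riesz_energy p K"
    proof (rule riesz_energy_linear_image_le[OF M I U pos])
      fix x :: "real^'n" assume x: "x \<noteq> 0"
      define y where "y = (1 / norm x) *\<^sub>R x"
      have y: "norm y = 1" "x = norm x *\<^sub>R y" using x by (auto simp: y_def)
      have "(\<Sum>i\<in>I. w i * norm (M *v (U i *v x)) powr - p) = norm x powr - p * g y"
        unfolding g_def sum_distrib_left
        by (subst y(2)) (simp add: matrix_vector_mult_scaleR powr_mult mult_ac)
      also have "\<dots> \<le> norm x powr - p * g z" using max[OF y(1)] by (intro mult_left_mono) auto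
      finally show "(\<Sum>i\<in>I. w i * norm (M *v (U i *v x)) powr - p) \<le> g z * norm x powr - p"
        by (simp add: mult.commute)
    qed auto
  qed fact
qed

lemma riesz_capacity_pos:
  fixes K :: "'a::euclidean_space set" and p :: real
  assumes "compact K" "0 < vol K" "0 < p" "p < DIM('a)"
  shows "0 < riesz_capacity p K" "riesz_capacity p K = enn2real (riesz_energy p K) powr (- 1 / p)"
    "0 < enn2real (riesz_energy p K)"
proof -
  have fin: "riesz_energy p K < \<infinity>" by (rule riesz_energy_finite[OF assms])
  show eq: "riesz_capacity p K = enn2real (riesz_energy p K) powr (- 1 / p)"
    using fin by (auto simp: riesz_capacity_def)
  show pos: "0 < enn2real (riesz_energy p K)"
    using riesz_energy_pos[OF assms(1,3)] fin by (simp add: enn2real_positive_iff)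
  show "0 < riesz_capacity p K" using pos by (simp add: eq)
qed

text \<open>Stated for two unrelated sets, because it is applied from \<open>K\<close> to its image
  and, in the equality case, from the image back to \<open>K\<close>.\<close>

lemma riesz_capacity_ge:
  fixes K :: "'a::euclidean_space set" and L :: "'b::euclidean_space set" and p :: real
  assumes K: "compact K" "0 < vol K" "p < DIM('a)" and L: "compact L" "0 < vol L" "p < DIM('b)"
    and p: "0 < p" and C: "0 < C" and le: "riesz_energy p L \<le> ennreal C * riesz_energy p K"
  shows "C powr (- 1 / p) * riesz_capacity p K \<le> riesz_capacity p L"
proof -
  note capK = riesz_capacity_pos[OF K(1,2) p K(3)] and capL = riesz_capacity_pos[OF L(1,2) p L(3)]
  have fin: "riesz_energy p K < \<infinity>" by (rule riesz_energy_finite[OF K(1,2) p K(3)])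
  then have "enn2real (riesz_energy p L) \<le> enn2real (ennreal C * riesz_energy p K)"
    by (intro enn2real_mono le) (auto simp: ennreal_mult_less_top)
  also have "\<dots> = C * enn2real (riesz_energy p K)" using C by (simp add: enn2real_mult)
  finally have "(C * enn2real (riesz_energy p K)) powr (- 1 / p) \<le> enn2real (riesz_energy p L) powr (- 1 / p)"
    using capL(3) p by (intro powr_mono2') auto
  then show ?thesis using C by (simp add: capK(2) capL(2) powr_mult)
qed

text \<open>The determinant enters with exponent n - 1 through the second moment and n + 1 through
  the volume; its square remains in the denominator.\<close>

lemma capacity_moment_ratio_matrix_image:
  fixes M :: "real^'n^'n"
  assumes n: "2 \<le> CARD('n)" and K: "compact K" and vol: "0 < vol K"
    and irr: "irreducible_group (isometry_group K)" and M: "invertible M"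
  shows "capacity_moment_ratio p (matrix_image M K)
    = riesz_capacity p (matrix_image M K) * sqrt (((norm M)\<^sup>2 / CARD('n)) ^ (CARD('n) - 1) / (det M)\<^sup>2)
      * sqrt (second_moment K ^ (CARD('n) - 1) / vol K ^ (CARD('n) + 1))"
proof -
  obtain m where m: "CARD('n) = Suc m" using n by (cases "CARD('n)") auto
  have J: "\<bar>det M\<bar> \<noteq> 0" using M invertible_det_nz[of M] by simp
  have quot: "(j * t * i) ^ m / (j * v) ^ (Suc m + 1) = (t ^ m / j\<^sup>2) * (i ^ m / v ^ (Suc m + 1))"
    if "j \<noteq> 0" for j t i v :: real
    using that by (simp add: power_mult_distrib power2_eq_square)
  show ?thesis
    unfolding capacity_moment_ratio_def second_moment_matrix_image[OF n K irr M] vol_matrix_image[OF M K] m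
    using quot[OF J] by (simp only: diff_Suc_1 real_sqrt_mult power2_abs mult.assoc)
qed

lemma euclidean_similarity_norm:
  fixes U :: "real^'n^'n"
  assumes U: "orthogonal_matrix U" and c: "c \<noteq> 0"
  shows "norm ((c *\<^sub>R U) *v x) = \<bar>c\<bar> * norm x" "(norm (c *\<^sub>R U))\<^sup>2 / CARD('n) = c\<^sup>2"
    "(det (c *\<^sub>R U))\<^sup>2 = (c\<^sup>2) ^ CARD('n)"
proof -
  show "norm ((c *\<^sub>R U) *v x) = \<bar>c\<bar> * norm x"
    using orthogonal_matrix_norm[OF U, of x] by (simp flip: scaleR_matrix_vector_assoc)
  have "(norm (c *\<^sub>R U))\<^sup>2 = c\<^sup>2 * (norm (U ** mat 1))\<^sup>2" by (simp add: power_mult_distrib)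
  also have "norm (U ** mat 1) = norm (mat 1 :: real^'n^'n)" by (rule norm_orthogonal_mult[OF U])
  also have "(norm (mat 1 :: real^'n^'n))\<^sup>2 = CARD('n)"
    by (simp add: norm_matrix_sq) (simp add: trace_def mat_def)
  finally show "(norm (c *\<^sub>R U))\<^sup>2 / CARD('n) = c\<^sup>2" by simp
  have "c *\<^sub>R U = diag_matrix (\<lambda>_. c) ** U" by (simp add: diag_matrix_const scaleR_matrix_mult)
  then have "\<bar>det (c *\<^sub>R U)\<bar> = \<bar>c\<bar> ^ CARD('n)"
    using abs_det_orthogonal[OF U] by (simp add: det_mul det_diag_matrix abs_mult power_abs)
  then show "(det (c *\<^sub>R U))\<^sup>2 = (c\<^sup>2) ^ CARD('n)"
    by (metis power2_abs power_mult mult.commute)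
qed

text \<open>\<open>p \<le> 2\<close> serves the tangent-line step and \<open>p < CARD('n)\<close>
  the finiteness of the energy; in the plane the latter also supplies the strict
  \<open>p < 2\<close> of the equality case.\<close>

lemma capacity_moment_ratio_minimal:
  fixes K :: "(real^'n) set" and p :: real
  assumes n: "2 \<le> CARD('n)" and K: "compact K" and vol: "0 < vol K"
    and p: "0 < p" "p < CARD('n)" "p \<le> 2"
    and irr: "irreducible_group (isometry_group K)" and M: "invertible M"
  shows "capacity_moment_ratio p K \<le> capacity_moment_ratio p (matrix_image M K)"
    and "capacity_moment_ratio p K = capacity_moment_ratio p (matrix_image M K) \<longleftrightarrow> euclidean_similarity M"
proof -
  let ?n = "CARD('n)" and ?L = "matrix_image M K"
  define t where "t = (norm (matrix_inv M))\<^sup>2 / ?n"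
  define t' where "t' = (norm M)\<^sup>2 / ?n"
  define X where "X = sqrt (second_moment K ^ (?n - 1) / vol K ^ (?n + 1))"
  define s where "s = sqrt (t' ^ (?n - 1) / (det M)\<^sup>2)"
  note det_norm = det_norm_ineq[OF M, folded t_def t'_def]
  have det: "0 < (det M)\<^sup>2" using M invertible_det_nz[of M] by simp
  have L: "compact ?L" "0 < vol ?L"
    using K vol det by (auto simp: compact_matrix_image vol_matrix_image[OF M K])
  have pD: "p < DIM(real^'n)" using p by simp
  have X: "0 < X" using second_moment_pos[OF K vol] vol by (simp add: X_def)
  have cK: "0 < riesz_capacity p K" and cL: "0 < riesz_capacity p ?L"
    using riesz_capacity_pos(1)[OF K vol p(1) pD] riesz_capacity_pos(1)[OF L p(1) pD] by auto
  have ratio_K: "capacity_moment_ratio p K = riesz_capacity p K * X"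
    by (simp add: capacity_moment_ratio_def X_def)
  have ratio_L: "capacity_moment_ratio p ?L = riesz_capacity p ?L * s * X"
    using capacity_moment_ratio_matrix_image[OF n K vol irr M, of p] by (simp add: t'_def s_def X_def)
  obtain C where C: "0 < C" "C \<le> t powr (p / 2)"
      "?n = 2 \<Longrightarrow> p < 2 \<Longrightarrow> \<not> euclidean_similarity M \<Longrightarrow> C < t powr (p / 2)"
    and energy: "riesz_energy p ?L \<le> ennreal C * riesz_energy p K"
    by (rule riesz_energy_matrix_image_bound[OF K irr M p(1,3), folded t_def]) (rule that)
  have cap: "C powr (- 1 / p) * riesz_capacity p K \<le> riesz_capacity p ?L"
    by (rule riesz_capacity_ge[OF K vol pD L pD p(1) C(1) energy])
  have root: "(t powr (p / 2)) powr (- 1 / p) = 1 / sqrt t"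
    using det_norm(1) p by (simp add: powr_powr powr_minus_divide powr_half_sqrt)
  have C_le: "1 / sqrt t \<le> C powr (- 1 / p)"
    unfolding root[symmetric] using C p by (intro powr_mono2') auto
  have C_less: "1 / sqrt t < C powr (- 1 / p)" if "?n = 2" "\<not> euclidean_similarity M"
    unfolding root[symmetric] using C that p by (intro powr_less_mono2_neg) auto
  have s_ge: "sqrt t \<le> s"
    unfolding s_def using det_norm(3) det by (simp add: field_simps)
  have s_gt: "sqrt t < s" if "3 \<le> ?n" "\<not> euclidean_similarity M"
    unfolding s_def using det_norm(4)[OF that] det by (simp add: field_simps)
  have st: "0 < sqrt t" "0 < s" using det_norm(1,2) det by (auto simp: s_def)
  have one_le: "1 \<le> C powr (- 1 / p) * s"
  proof -
    have "1 = 1 / sqrt t * sqrt t" using st by simp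
    also have "\<dots> \<le> C powr (- 1 / p) * s" using C_le s_ge st by (intro mult_mono) auto
    finally show ?thesis .
  qed
  \<comment> \<open>In the plane strictness lies in \<open>C\<close>, in higher dimensions in
    \<open>s\<close>; the other factor contributes its weak bound.\<close>
  have one_less: "1 < C powr (- 1 / p) * s" if ns: "\<not> euclidean_similarity M"
  proof -
    have "1 = 1 / sqrt t * sqrt t" using st by simp
    also have "\<dots> < C powr (- 1 / p) * s"
    proof (cases "?n = 2")
      case True
      have "1 / sqrt t * sqrt t < C powr (- 1 / p) * sqrt t"
        using C_less[OF True ns] st by (intro mult_strict_right_mono) auto
      also have "\<dots> \<le> C powr (- 1 / p) * s" using s_ge by (intro mult_left_mono) auto
      finally show ?thesis .
    next
      case False
      then have "3 \<le> ?n" using n by simp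
      have "1 / sqrt t * sqrt t < 1 / sqrt t * s"
        using s_gt[OF \<open>3 \<le> ?n\<close> ns] st by (intro mult_strict_left_mono) auto
      also have "\<dots> \<le> C powr (- 1 / p) * s" using C_le st by (intro mult_right_mono) auto
      finally show ?thesis .
    qed
    finally show ?thesis .
  qed
  have lower: "(C powr (- 1 / p) * s) * (riesz_capacity p K * X) \<le> capacity_moment_ratio p ?L"
    unfolding ratio_L using mult_right_mono[OF cap, of "s * X"] st X by (simp add: mult_ac)
  have KX: "0 < riesz_capacity p K * X" using cK X by simp
  show le: "capacity_moment_ratio p K \<le> capacity_moment_ratio p ?L"
    using lower mult_right_mono[OF one_le, of "riesz_capacity p K * X"] KX by (simp add: ratio_K)
  have strict: "capacity_moment_ratio p K < capacity_moment_ratio p ?L" if "\<not> euclidean_similarity M"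
    using lower mult_strict_right_mono[OF one_less[OF that] KX] by (simp add: ratio_K)
  \<comment> \<open>A similarity scales all distances by one factor, so the energy bound holds
    sharply for the inverse matrix with the identity as the only isometry. This gives the reverse
    inequality.\<close>
  have ge: "capacity_moment_ratio p ?L \<le> capacity_moment_ratio p K" if sim: "euclidean_similarity M"
  proof -
    obtain c U where c: "c \<noteq> 0" and U: "orthogonal_matrix U" and MU: "M = c *\<^sub>R U"
      using sim by (auto simp: euclidean_similarity_def)
    note sim_norm = euclidean_similarity_norm[OF U c, folded MU]
    note inv = invertible_matrix_inv[OF M]
    have iM: "invertible (matrix_inv M)" using inv by (auto simp: invertible_def)
    have img: "matrix_image (matrix_inv M) ?L = K"
      by (simp add: inv flip: matrix_image_mult)
    have norm_inv: "norm z = \<bar>c\<bar> * norm (matrix_inv M *v z)" for z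
      using sim_norm(1)[of "matrix_inv M *v z"] inv by (simp add: matrix_vector_mul_assoc)
    have "norm (matrix_inv M *v z) powr - p \<le> \<bar>c\<bar> powr p * norm z powr - p" for z
    proof -
      have "norm z powr - p = \<bar>c\<bar> powr - p * norm (matrix_inv M *v z) powr - p"
        by (subst norm_inv) (simp add: powr_mult)
      then show ?thesis using c by (simp flip: mult.assoc powr_add)
    qed
    then have "riesz_energy p (matrix_image (matrix_inv M) ?L) \<le> ennreal (\<bar>c\<bar> powr p) * riesz_energy p ?L"
      using c by (intro riesz_energy_linear_image_le[OF iM, of "{()}" "\<lambda>_. 1" "\<lambda>_. mat 1"])
        (auto simp: isometry_group_def isometry_of_def orthogonal_matrix_id)
    then have "(\<bar>c\<bar> powr p) powr (- 1 / p) * riesz_capacity p ?L \<le> riesz_capacity p K"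
      unfolding img using c by (intro riesz_capacity_ge[OF L pD K vol pD p(1)]) auto
    moreover have "(\<bar>c\<bar> powr p) powr (- 1 / p) = 1 / \<bar>c\<bar>"
      using p c by (simp add: powr_powr powr_minus_divide)
    ultimately have cap_le: "riesz_capacity p ?L * (1 / \<bar>c\<bar>) \<le> riesz_capacity p K" by (simp add: mult.commute)
    \<comment> \<open>Here \<open>t'\<close> is \<open>c^2\<close> and \<open>(det M)^2\<close> is
      its n-th power, so the quotient under the root is \<open>1 / c^2\<close>.\<close>
    have "s = 1 / \<bar>c\<bar>"
    proof -
      obtain m where m: "?n = Suc m" using n by (cases ?n) auto
      have "t' = c\<^sup>2" unfolding t'_def by (rule sim_norm(2))
      then have "t' ^ (?n - 1) / (det M)\<^sup>2 = 1 / c\<^sup>2"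
        using c by (simp add: sim_norm(3) m)
      then show ?thesis by (simp add: s_def real_sqrt_divide)
    qed
    then show ?thesis
      using mult_right_mono[OF cap_le, of X] X by (simp add: ratio_K ratio_L)
  qed
  show "capacity_moment_ratio p K = capacity_moment_ratio p ?L \<longleftrightarrow> euclidean_similarity M"
    using le strict ge by fastforce
qed

text \<open>Since \<open>3 \<le> N\<close>, the angle \<open>a\<close> lies strictly between 0 and
  \<open>pi\<close> and \<open>sin a\<close> is nonzero. An invariant subspace containing
  \<open>v \<noteq> 0\<close> then contains \<open>?R *v v - cos a *\<^sub>R v\<close>, a nonzero
  multiple of the perpendicular of \<open>v\<close>, and so the whole plane.\<close>

lemma rotational_symmetry_irreducible:
  fixes K :: "(real^2) set"
  assumes N: "3 \<le> N" and K: "rotational_symmetry N K"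
  shows "irreducible_group (isometry_group K)"
proof -
  define a where "a = 2 * pi / real N"
  have "0 < a" "a < pi" using N by (auto simp: a_def field_simps)
  then have sin: "sin a \<noteq> 0" using sin_gt_zero[of a] by simp
  let ?R = "rotation_matrix a"
  have R_apply: "?R *v x = vector [cos a * x$1 - sin a * x$2, sin a * x$1 + cos a * x$2]" for x
    by (simp add: rotation_matrix_def vec_eq_iff forall_2 matrix_vector_mult_def sum_2)
  have "norm (?R *v x) = norm x" for x
  proof -
    have "(cos a * x$1 - sin a * x$2)\<^sup>2 + (sin a * x$1 + cos a * x$2)\<^sup>2 = ((cos a)\<^sup>2 + (sin a)\<^sup>2) * ((x$1)\<^sup>2 + (x$2)\<^sup>2)"
      by algebra
    then show ?thesis by (simp add: R_apply norm_vec_def L2_set_def sum_2)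
  qed
  then have "orthogonal_transformation ((*v) ?R)" by (simp add: orthogonal_transformation)
  then have "orthogonal_matrix ?R" by (simp add: orthogonal_transformation_matrix)
  then have R: "?R \<in> isometry_group K"
    using K by (simp add: isometry_group_def isometry_of_def rotational_symmetry_def a_def)
  show ?thesis unfolding irreducible_group_def
  proof (intro allI impI)
    fix S :: "(real^2) set"
    assume S: "subspace S \<and> (\<forall>U\<in>isometry_group K. matrix_image U S \<subseteq> S)"
    show "S = {0} \<or> S = UNIV"
    proof (cases "S = {0}")
      case False
      then obtain v where v: "v \<in> S" "v \<noteq> 0" using S subspace_0 by blast
      have Rv: "?R *v v \<in> S" using S R v by (auto simp: matrix_image_def)
      define d where "d = (v$1)\<^sup>2 + (v$2)\<^sup>2"
      have d: "d \<noteq> 0" using v(2) by (auto simp: d_def vec_eq_iff forall_2 sum_power2_eq_zero_iff)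
      have perp: "vector [- v$2, v$1] \<in> S"
      proof -
        have "vector [- v$2, v$1] = (1 / sin a) *\<^sub>R (?R *v v - cos a *\<^sub>R v)"
          using sin by (simp add: vec_eq_iff forall_2 R_apply)
        then show ?thesis using S v Rv by (auto intro!: subspace_scale subspace_diff)
      qed
      have "x \<in> S" for x
      proof -
        \<comment> \<open>The coordinates of \<open>x\<close> in the orthogonal basis formed by
          \<open>v\<close> and its perpendicular, both of squared length \<open>d\<close>.\<close>
        define k l where "k = (x$1 * v$1 + x$2 * v$2) / d" and "l = (x$2 * v$1 - x$1 * v$2) / d"
        have "x = k *\<^sub>R v + l *\<^sub>R vector [- v$2, v$1]"
        proof -
          have "x$1 * d = (x$1 * v$1 + x$2 * v$2) * v$1 - (x$2 * v$1 - x$1 * v$2) * v$2"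
            "x$2 * d = (x$1 * v$1 + x$2 * v$2) * v$2 + (x$2 * v$1 - x$1 * v$2) * v$1"
            by (simp_all add: d_def power2_eq_square algebra_simps)
          then have "x$1 = k * v$1 - l * v$2" "x$2 = k * v$2 + l * v$1"
            using d by (simp_all add: k_def l_def field_simps)
          then show ?thesis by (simp add: vec_eq_iff forall_2)
        qed
        then show ?thesis using S v perp by (metis subspace_add subspace_scale)
      qed
      then show ?thesis by blast
    qed simp
  qed
qed

theorem corollary1p4:
  "(\<forall>(K :: (real^'n) set) (p :: real).
      2 \<le> CARD('n) \<and> compact K \<and> 0 < vol K \<and>
      0 < p \<and> (CARD('n) = 2 \<longrightarrow> p < 2) \<and> (3 \<le> CARD('n) \<longrightarrow> p \<le> 2 / (real CARD('n) - 1)) \<and>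
      has_irreducible_isometry_group K \<longrightarrow>
      (\<forall>M :: real^'n^'n. invertible M \<longrightarrow>
         capacity_moment_ratio p K \<le> capacity_moment_ratio p (matrix_image M K) \<and>
         (capacity_moment_ratio p K = capacity_moment_ratio p (matrix_image M K)
            \<longleftrightarrow> euclidean_similarity M)))
   \<and>
   (\<forall>K :: (real^2) set.
      compact K \<and> 0 < vol K \<and> (\<exists>N\<ge>3. rotational_symmetry N K) \<longrightarrow>
      (\<forall>M :: real^2^2. invertible M \<longrightarrow>
         riesz_capacity 1 K * sqrt (second_moment K / vol K ^ 3)
         \<le> riesz_capacity 1 (matrix_image M K) *
             sqrt (second_moment (matrix_image M K) / vol (matrix_image M K) ^ 3)))
   \<and>
   (\<forall>K :: (real^3) set.
      compact K \<and> 0 < vol K \<and> has_irreducible_isometry_group K \<longrightarrow>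
      (\<forall>M :: real^3^3. invertible M \<longrightarrow>
         riesz_capacity 1 K * second_moment K / (vol K)\<^sup>2
         \<le> riesz_capacity 1 (matrix_image M K) * second_moment (matrix_image M K) /
             (vol (matrix_image M K))\<^sup>2))"
proof (intro conjI allI impI)
  fix K :: "(real^'n) set" and p :: real and M :: "real^'n^'n"
  assume *: "2 \<le> CARD('n) \<and> compact K \<and> 0 < vol K \<and>
      0 < p \<and> (CARD('n) = 2 \<longrightarrow> p < 2) \<and> (3 \<le> CARD('n) \<longrightarrow> p \<le> 2 / (real CARD('n) - 1)) \<and>
      has_irreducible_isometry_group K" and M: "invertible M"
  \<comment> \<open>In dimension at least 3 the upper bound on \<open>p\<close> is at most
    1.\<close>
  have "p < 2"
  proof (cases "CARD('n) = 2")
    case False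
    then have "3 \<le> CARD('n)" using * by linarith
    moreover from this have "2 / (real CARD('n) - 1) \<le> 1" by (simp add: field_simps)
    ultimately show ?thesis using * by linarith
  qed (use * in auto)
  then have "p < CARD('n)" "p \<le> 2" using * by linarith+
  with * show "capacity_moment_ratio p K \<le> capacity_moment_ratio p (matrix_image M K)"
    "capacity_moment_ratio p K = capacity_moment_ratio p (matrix_image M K) \<longleftrightarrow> euclidean_similarity M"
    using capacity_moment_ratio_minimal[OF _ _ _ _ _ _ isometry_group_irreducible M] by blast+
next
  fix K :: "(real^2) set" and M :: "real^2^2"
  assume *: "compact K \<and> 0 < vol K \<and> (\<exists>N\<ge>3. rotational_symmetry N K)" and M: "invertible M"
  then have "irreducible_group (isometry_group K)" using rotational_symmetry_irreducible by blast
  then have "capacity_moment_ratio 1 K \<le> capacity_moment_ratio 1 (matrix_image M K)"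
    using * M by (intro capacity_moment_ratio_minimal) auto
  then show "riesz_capacity 1 K * sqrt (second_moment K / vol K ^ 3)
         \<le> riesz_capacity 1 (matrix_image M K) *
             sqrt (second_moment (matrix_image M K) / vol (matrix_image M K) ^ 3)"
    by (simp add: capacity_moment_ratio_def)
next
  fix K :: "(real^3) set" and M :: "real^3^3"
  assume *: "compact K \<and> 0 < vol K \<and> has_irreducible_isometry_group K" and M: "invertible M"
  \<comment> \<open>In dimension 3 the exponents are 2 and 4, so the quotient is a perfect square
    and the root disappears.\<close>
  have root: "sqrt (second_moment L ^ 2 / vol L ^ 4) = second_moment L / (vol L)\<^sup>2"
    if "compact L" "0 < vol L" for L :: "(real^3) set"
  proof -
    have "sqrt (vol L ^ 4) = (vol L)\<^sup>2" by (rule real_sqrt_unique) (simp_all flip: power_mult)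
    then show ?thesis using second_moment_pos[OF that] by (simp add: real_sqrt_divide)
  qed
  have L: "compact (matrix_image M K)" "0 < vol (matrix_image M K)"
    using * M invertible_det_nz[of M] by (auto simp: compact_matrix_image vol_matrix_image)
  have "capacity_moment_ratio 1 K \<le> capacity_moment_ratio 1 (matrix_image M K)"
    using * M by (intro capacity_moment_ratio_minimal isometry_group_irreducible) auto
  then show "riesz_capacity 1 K * second_moment K / (vol K)\<^sup>2
         \<le> riesz_capacity 1 (matrix_image M K) * second_moment (matrix_image M K) /
             (vol (matrix_image M K))\<^sup>2"
    using root[of K] root[OF L] * by (simp add: capacity_moment_ratio_def)
qed

end
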